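(* Let $P_2(t)=(P_2^{ij}(t))$ be a positive definite (symmetric) $d\times d$ matrix of smooth real functions of $t$, and let $B_0(t)=(P_2^{ij}(t)\xi_i\xi_j-\lambda)^{-1}$. Let $\vec\alpha=(\alpha_0,\dots,\alpha_n)$ be a tuple of positive integers with $|\vec\alpha|=\sum_j\alpha_j\ge2$, let $\vec n=(n_1,\dots,n_{2|\vec\alpha|-4})$ with $n_i\in\{1,\dots,d\}$, and let $$T_{\vec n;\vec\alpha}(t_0,\dots,t_n)=\frac{-1}{\pi^{d/2}}\int_{\mathbb{R}^d}\xi_{n_1}\cdots\xi_{n_{2|\vec\alpha|-4}}\frac1{2\pi i}\int_\gamma e^{-\lambda}B_0^{\alpha_0}(t_0)\cdots B_0^{\alpha_n}(t_n)\,d\lambda\,d\xi .$$ Then $$T_{\vec n;\vec\alpha}(t_0,\dots,t_n)=\frac1{2^{|\vec\alpha|-2}\,\vec\beta!}\int_{\Sigma_n}\prod_{j=0}^ns_j^{\alpha_j-1}\;\frac{\underset{\vec n}{\sum\prod}\,P^{-1}(s)_{n_in_{\sigma(i)}}}{\sqrt{\det P(s)}}\,ds,$$ where $P(s)=\sum_{j=0}^ns_jP_2(t_j)$ and $\vec\beta=(\alpha_0-1,\dots,\alpha_n-1)$.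
   Context: $\gamma$ is a contour going counterclockwise around $[0,\infty)\subset\mathbb{C}$ (from $+\infty$ above the real axis, around $0$, to $+\infty$ below the axis). Einstein summation is used in $P_2^{ij}\xi_i\xi_j$. $\vec\beta!=\prod_j(\alpha_j-1)!$. $\Sigma_n=\{(s_0,\dots,s_n)\in\mathbb{R}^{n+1}:\sum s_j=1,\ s_j\ge0\}$ is the standard simplex, with $ds$ the Lebesgue measure $ds_1\cdots ds_n$ (so that $\Sigma_n$ has volume $1/n!$). For a symmetric matrix $M$ and an index tuple $\vec n=(n_1,\dots,n_{2k})$, $\underset{\vec n}{\sum\prod}M_{n_in_{\sigma(i)}}$ denotes the sum over all pairings (perfect matchings) $\sigma$ of $\{1,\dots,2k\}$ of the product over the pairs $\{i,\sigma(i)\}$ of $M_{n_in_{\sigma(i)}}$ (equal to $1$ when $k=0$); e.g. for $(k,\ell,m,n)$ it is $M_{k\ell}M_{mn}+M_{km}M_{\ell n}+M_{kn}M_{\ell m}$. *)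

theory Defs
  imports "HOL-Analysis.Analysis" "HOL-Combinatorics.Permutations"
begin

definition positive_definite :: "real^'d^'d \<Rightarrow> bool" where
  "positive_definite M \<longleftrightarrow> transpose M = M \<and> (\<forall>x. x \<noteq> 0 \<longrightarrow> 0 < x \<bullet> (M *v x))"

text \<open>For open \<open>S\<close>, the values on \<open>S\<close> of the iterated derivatives depend only on \<open>f\<close>
  restricted to \<open>S\<close>.\<close>

definition smooth_on :: "real set \<Rightarrow> (real \<Rightarrow> real) \<Rightarrow> bool" where
  "smooth_on S f \<longleftrightarrow> (\<forall>k. \<forall>x\<in>S. (deriv ^^ k) f differentiable at x)"

text \<open>Contours are parametrised by the whole real line. The complement of $[0,\infty)$ is simply
  connected, so the conditions below determine the homotopy class of the contour: it comes in from
  $+\infty$ above the axis, passes around $0$ and leaves to $+\infty$ below the axis.\<close>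

definition encircles_nonneg_axis :: "(real \<Rightarrow> complex) \<Rightarrow> bool" where
  "encircles_nonneg_axis \<gamma> \<longleftrightarrow>
     (\<forall>a b. a < b \<longrightarrow> \<gamma> piecewise_C1_differentiable_on {a..b}) \<and>
     range \<gamma> \<inter> \<real>\<^sub>\<ge>\<^sub>0 = {} \<and>
     filterlim (\<lambda>u. Re (\<gamma> u)) at_top at_bot \<and> (\<forall>\<^sub>F u in at_bot. 0 < Im (\<gamma> u)) \<and>
     filterlim (\<lambda>u. Re (\<gamma> u)) at_top at_top \<and> (\<forall>\<^sub>F u in at_top. Im (\<gamma> u) < 0)"

text \<open>A Henstock-Kurzweil integral over \<open>UNIV\<close> is the limit of the integrals over \<open>{a..b}\<close> as
  \<open>a\<close> and \<open>b\<close> tend to $-\infty$ and $+\infty$, so these are improper contour integrals.\<close>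

definition line_integrable :: "(real \<Rightarrow> complex) \<Rightarrow> (complex \<Rightarrow> complex) \<Rightarrow> bool" where
  "line_integrable \<gamma> f \<longleftrightarrow> (\<lambda>u. f (\<gamma> u) * vector_derivative \<gamma> (at u)) integrable_on UNIV"

definition line_integral :: "(real \<Rightarrow> complex) \<Rightarrow> (complex \<Rightarrow> complex) \<Rightarrow> complex" where
  "line_integral \<gamma> f = integral UNIV (\<lambda>u. f (\<gamma> u) * vector_derivative \<gamma> (at u))"

text \<open>Tuples $(x_0,\dots,x_n)$ and $(n_1,\dots,n_m)$ are functions on \<open>nat\<close>, of which only the values
  at \<open>0, ..., n\<close> and \<open>1, ..., m\<close>, respectively, are used.\<close>

definition tuple_abs :: "nat \<Rightarrow> (nat \<Rightarrow> nat) \<Rightarrow> nat" where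
  "tuple_abs n \<alpha> = (\<Sum>j\<le>n. \<alpha> j)"

definition B0 :: "(real \<Rightarrow> real^'d^'d) \<Rightarrow> real \<Rightarrow> real^'d \<Rightarrow> complex \<Rightarrow> complex" where
  "B0 P2 t \<xi> z = inverse (of_real (\<Sum>i\<in>UNIV. \<Sum>j\<in>UNIV. P2 t $ i $ j * \<xi> $ i * \<xi> $ j) - z)"

definition contour_integrand ::
    "(real \<Rightarrow> real^'d^'d) \<Rightarrow> nat \<Rightarrow> (nat \<Rightarrow> nat) \<Rightarrow> (nat \<Rightarrow> real) \<Rightarrow> real^'d \<Rightarrow> complex \<Rightarrow> complex" where
  "contour_integrand P2 n \<alpha> t \<xi> z = exp (- z) * (\<Prod>j\<le>n. B0 P2 (t j) \<xi> z ^ \<alpha> j)"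

definition T_integrand ::
    "(real \<Rightarrow> complex) \<Rightarrow> (real \<Rightarrow> real^'d^'d) \<Rightarrow> (nat \<Rightarrow> 'd) \<Rightarrow> nat \<Rightarrow> (nat \<Rightarrow> nat) \<Rightarrow> (nat \<Rightarrow> real)
      \<Rightarrow> real^'d \<Rightarrow> complex" where
  "T_integrand \<gamma> P2 ns n \<alpha> t \<xi> =
     of_real (\<Prod>i=1..2 * tuple_abs n \<alpha> - 4. \<xi> $ ns i) *
     (1 / (2 * of_real pi * \<i>) * line_integral \<gamma> (contour_integrand P2 n \<alpha> t \<xi>))"

definition T_fun ::
    "(real \<Rightarrow> complex) \<Rightarrow> (real \<Rightarrow> real^'d^'d) \<Rightarrow> (nat \<Rightarrow> 'd) \<Rightarrow> nat \<Rightarrow> (nat \<Rightarrow> nat) \<Rightarrow> (nat \<Rightarrow> real)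
      \<Rightarrow> complex" where
  "T_fun \<gamma> P2 ns n \<alpha> t =
     of_real (- 1 / pi powr (real CARD('d) / 2)) *
     (LINT \<xi>|lborel. T_integrand \<gamma> P2 ns n \<alpha> t \<xi>)"

definition simplex_pts :: "nat \<Rightarrow> (nat \<Rightarrow> real) set" where
  "simplex_pts n = {s \<in> {0..n} \<rightarrow>\<^sub>E UNIV. (\<forall>j\<in>{0..n}. 0 \<le> s j) \<and> (\<Sum>j=0..n. s j) = 1}"

text \<open>The measure $ds_1\cdots ds_n$ on the hyperplane $s_0+\dots+s_n=1$, transported along
  $(s_1,\dots,s_n)\mapsto(1-s_1-\dots-s_n,s_1,\dots,s_n)$. For \<open>n = 0\<close> it is a point mass.\<close>

definition simplex_measure :: "nat \<Rightarrow> (nat \<Rightarrow> real) measure" where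
  "simplex_measure n =
     distr (Pi\<^sub>M {1..n} (\<lambda>_. lborel)) (Pi\<^sub>M {0..n} (\<lambda>_. borel)) (\<lambda>s. s(0 := 1 - (\<Sum>j=1..n. s j)))"

lemma emeasure_simplex_pts: "emeasure (simplex_measure n) (simplex_pts n) = ennreal (1 / fact n)"
proof -
  let ?f = "\<lambda>s. s(0 := 1 - (\<Sum>j=1..n. s j)) :: nat \<Rightarrow> real"
  let ?M = "Pi\<^sub>M {1..n} (\<lambda>_. lborel::real measure)"
  let ?N = "Pi\<^sub>M {0..n} (\<lambda>_. borel::real measure)"
  have i: "{0..n} = insert 0 {1..n}" by auto
  have "simplex_pts n = {s \<in> space ?N. (\<forall>j\<in>{0..n}. 0 \<le> s j) \<and> (\<Sum>j=0..n. s j) = 1}"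
    by (auto simp: simplex_pts_def space_PiM)
  also have "\<dots> \<in> sets ?N" by measurable
  finally have m: "simplex_pts n \<in> sets ?N" .
  have f: "?f \<in> measurable ?M ?N"
    unfolding i by (rule measurable_fun_upd[where J="{1..n}"]) (auto intro!: measurable_PiM_single')
  have "?f -` simplex_pts n \<inter> space ?M = {x. (\<forall>i\<in>{1..n}. 0 \<le> x i) \<and> sum x {1..n} \<le> 1} \<inter> space ?M"
    unfolding simplex_pts_def i
    by (auto simp: space_PiM PiE_def extensional_def intro!: sum.cong cong: sum.cong_simp split: if_splits)
  then show ?thesis
    unfolding simplex_measure_def
    by (subst emeasure_distr[OF f m]) (simp add: emeasure_std_simplex_aux ennreal_fact[symmetric] divide_ennreal[symmetric])
qed

text \<open>A perfect matching is encoded as its partner map, a fixed-point free involution. The condition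
  \<open>permutes\<close> makes the map the identity off \<open>A\<close>, so that each matching is counted once.\<close>

definition pairings :: "nat set \<Rightarrow> (nat \<Rightarrow> nat) set" where
  "pairings A = {\<sigma>. \<sigma> permutes A \<and> (\<forall>i\<in>A. \<sigma> i \<noteq> i \<and> \<sigma> (\<sigma> i) = i)}"

definition pairing_sum :: "real^'d^'d \<Rightarrow> (nat \<Rightarrow> 'd) \<Rightarrow> nat \<Rightarrow> real" where
  "pairing_sum M ns m =
     (\<Sum>\<sigma>\<in>pairings {1..m}. \<Prod>i\<in>{i\<in>{1..m}. i < \<sigma> i}. M $ ns i $ ns (\<sigma> i))"

definition P_comb :: "(real \<Rightarrow> real^'d^'d) \<Rightarrow> nat \<Rightarrow> (nat \<Rightarrow> real) \<Rightarrow> (nat \<Rightarrow> real) \<Rightarrow> real^'d^'d" where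
  "P_comb P2 n t s = (\<Sum>j\<le>n. s j *\<^sub>R P2 (t j))"

definition simplex_integrand ::
    "(real \<Rightarrow> real^'d^'d) \<Rightarrow> (nat \<Rightarrow> 'd) \<Rightarrow> nat \<Rightarrow> (nat \<Rightarrow> nat) \<Rightarrow> (nat \<Rightarrow> real) \<Rightarrow> (nat \<Rightarrow> real)
      \<Rightarrow> real" where
  "simplex_integrand P2 ns n \<alpha> t s =
     (\<Prod>j\<le>n. s j ^ (\<alpha> j - 1)) *
     (pairing_sum (matrix_inv (P_comb P2 n t s)) ns (2 * tuple_abs n \<alpha> - 4) /
      sqrt (det (P_comb P2 n t s)))"

end

theory Submission
  imports Defs "HOL-Complex_Analysis.Complex_Analysis" "HOL-Probability.Probability"
begin

text \<open>Both sides are integrals, in the two possible orders, of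
  $\prod_j s_j^{\alpha_j-1}\,\xi_{n_1}\cdots\xi_{n_{2k}}\,e^{-\xi\cdot P(s)\xi}$ over
  $\Sigma_n\times\mathbb{R}^d$, where $k=|\vec\alpha|-2$.

  Integrating over $\Sigma_n$ first gives the contour integral. With $q_j=\xi\cdot P_2(t_j)\xi$, set
  $h_n(r)=\frac1{2\pi i}\int_\gamma e^{-r\lambda}\prod_{j\le n}(q_j-\lambda)^{-\alpha_j}\,d\lambda$.
  The contour can be replaced by a large circle, and on the circle one computes that $h_{n+1}$ is the
  convolution of $h_n$ with $v\mapsto v^{\alpha_{n+1}-1}e^{-vq_{n+1}}/(\alpha_{n+1}-1)!$. An integral
  over $\Sigma_n$ of a product of functions of the $s_j$ is such an iterated convolution, evaluated at
  $r=1$.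

  Integrating over $\mathbb{R}^d$ first gives a Gaussian moment. A linear change of variables reduces it
  to the weight $e^{-|\xi|^2}$, for which integration by parts yields Wick's formula by recursion on
  the number of linear factors.\<close>

section \<open>Contours around the nonnegative real axis\<close>

lemma nonneg_axis_eq: "(\<real>\<^sub>\<ge>\<^sub>0 :: complex set) = of_real ` {0..}"
  by (auto simp: nonneg_Reals_def)

lemma convex_Re_gt: "convex {z. a < Re z}"
  using convex_halfspace_gt[of a "1::complex"] by (simp add: inner_complex_def)

lemma convex_upper_half_plane: "convex {z. 0 < Im z}"
  using convex_halfspace_gt[of 0 "\<i>"] by (simp add: inner_complex_def)

lemma convex_lower_half_plane: "convex {z. Im z < 0}"
  using convex_halfspace_lt[of "\<i>" 0] by (simp add: inner_complex_def)

text \<open>The two primitives differ by one constant above and by another one below the axis; the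
  difference of these constants is the integral over any curve that runs around the axis.\<close>

lemma slit_primitives:
  assumes "f holomorphic_on - \<real>\<^sub>\<ge>\<^sub>0" and "f holomorphic_on {z. a < Re z}"
  obtains F G c d where
    "\<And>z. z \<in> - \<real>\<^sub>\<ge>\<^sub>0 \<Longrightarrow> (F has_field_derivative f z) (at z)"
    "\<And>z. a < Re z \<Longrightarrow> (G has_field_derivative f z) (at z)"
    "\<And>z. a < Re z \<Longrightarrow> 0 < Im z \<Longrightarrow> F z = G z + c"
    "\<And>z. a < Re z \<Longrightarrow> Im z < 0 \<Longrightarrow> F z = G z + d"
proof -
  let ?S = "- \<real>\<^sub>\<ge>\<^sub>0 :: complex set" and ?U = "{z. a < Re z}"
  have S: "open ?S"
    by (simp add: closed_nonneg_Reals_complex open_Compl)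
  have U: "open ?U" by (simp add: open_halfspace_Re_gt)
  obtain F where F: "\<And>z. z \<in> ?S \<Longrightarrow> (F has_field_derivative f z) (at z)"
    using holomorphic_starlike_primitive[of ?S f "{}"] starlike_slotted_complex_plane_right[of 0] assms(1) S
    by (auto simp: nonneg_axis_eq holomorphic_on_imp_continuous_on holomorphic_on_open field_differentiable_def)
  obtain G where "\<And>z. z \<in> ?U \<Longrightarrow> (G has_field_derivative f z) (at z within ?U)"
    using holomorphic_convex_primitive'[OF convex_Re_gt U assms(2)] by blast
  then have G: "\<And>z. z \<in> ?U \<Longrightarrow> (G has_field_derivative f z) (at z)"
    using U at_within_open by metis
  \<comment> \<open>Both sides of the axis at once: an open half-plane cut by \<open>?U\<close> is
    convex, hence connected, so a difference of primitives is constant on it.\<close>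
  have const: "\<exists>c. \<forall>z\<in>H \<inter> ?U. F z - G z = c" if "convex H" "H \<subseteq> ?S" for H
  proof (rule has_field_derivative_zero_constant)
    show "convex (H \<inter> ?U)" using that(1) convex_Re_gt by (rule convex_Int)
    fix z assume "z \<in> H \<inter> ?U"
    then have "((\<lambda>z. F z - G z) has_field_derivative f z - f z) (at z)"
      using that(2) by (intro DERIV_diff F G) auto
    then show "((\<lambda>z. F z - G z) has_field_derivative 0) (at z within H \<inter> ?U)"
      by (simp add: has_field_derivative_at_within)
  qed
  obtain c where c: "\<And>z. z \<in> {z. 0 < Im z} \<inter> ?U \<Longrightarrow> F z - G z = c"
    using const[OF convex_upper_half_plane] by (force simp: complex_nonneg_Reals_iff)
  obtain d where d: "\<And>z. z \<in> {z. Im z < 0} \<inter> ?U \<Longrightarrow> F z - G z = d"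
    using const[OF convex_lower_half_plane] by (force simp: complex_nonneg_Reals_iff)
  show thesis
    by (rule that[of F G c d]) (use F G c d in \<open>auto simp: algebra_simps\<close>)
qed

text \<open>The circle starts and ends at \<open>R\<close>, on the cut, where \<open>F\<close> says
  nothing. Nearby \<open>F\<close> is \<open>G\<close> plus a constant, \<open>c\<close> on leaving
  and \<open>d\<close> on returning, so \<open>F\<close> along the circle extends continuously to
  the closed parameter interval. The fundamental theorem needs derivatives in its interior only, and
  the two end values differ by d - c.\<close>

lemma circlepath_slit_primitives:
  assumes F: "\<And>z. z \<in> - \<real>\<^sub>\<ge>\<^sub>0 \<Longrightarrow> (F has_field_derivative f z) (at z)"
    and G: "\<And>z. a < Re z \<Longrightarrow> (G has_field_derivative f z) (at z)"
    and c: "\<And>z. a < Re z \<Longrightarrow> 0 < Im z \<Longrightarrow> F z = G z + c"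
    and d: "\<And>z. a < Re z \<Longrightarrow> Im z < 0 \<Longrightarrow> F z = G z + d"
    and R: "0 < R" "a < R"
  shows "(f has_contour_integral (d - c)) (circlepath 0 R)"
proof -
  let ?g = "circlepath 0 R"
  define \<Phi> where "\<Phi> x = (if x = 0 then G (of_real R) + c else if x = 1 then G (of_real R) + d else F (?g x))" for x
  have g: "?g x = of_real R * cis (2 * pi * x)" for x
    by (simp add: circlepath cis_conv_exp mult_ac)
  have gS: "?g x \<in> - \<real>\<^sub>\<ge>\<^sub>0" if "0 < x" "x < 1" for x
  proof
    assume "?g x \<in> \<real>\<^sub>\<ge>\<^sub>0"
    then have s: "sin (2 * pi * x) = 0" and co: "0 \<le> cos (2 * pi * x)"
      using R by (auto simp: g complex_nonneg_Reals_iff zero_le_mult_iff)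
    then have "cos (2 * pi * x) = 1"
      using sin_cos_squared_add[of "2 * pi * x"] by (simp add: power2_eq_1_iff)
    then obtain k where "2 * pi * x = of_int k * 2 * pi"
      by (auto simp: cos_one_2pi_int)
    then have "x = of_int k" by simp
    with that show False by auto
  qed
  have gc: "continuous (at x within X) ?g" for x X
    unfolding circlepath by (intro continuous_intros)
  have gG: "continuous (at x within X) (\<lambda>x. G (?g x))" if "?g x = of_real R" for x X
    using R that
    by (intro continuous_within_compose3[OF _ gc] DERIV_isCont[OF G]) auto
  have near: "\<forall>\<^sub>F y in at x within X. a < Re (?g y)" if "?g x = of_real R" for x X
  proof -
    have "((\<lambda>y. Re (?g y)) \<longlongrightarrow> R) (at x within X)"
      using gc[of x X] that tendsto_Re[of ?g "of_real R"] by (simp add: continuous_within)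
    then show ?thesis using R(2) by (rule order_tendstoD)
  qed
  have cont: "continuous_on {0..1} \<Phi>"
    unfolding continuous_on_eq_continuous_within
  proof
    fix x :: real assume x: "x \<in> {0..1}"
    consider "x = 0" | "x = 1" | "0 < x" "x < 1" using x by fastforce
    then show "continuous (at x within {0..1}) \<Phi>"
    proof cases
      case 1
      have "\<forall>\<^sub>F y in at 0 within {0..1}. G (?g y) + c = \<Phi> y"
      proof -
        have e: "\<forall>\<^sub>F y in at (0::real) within {0..1}. y < 1/2 \<and> 0 < y"
          unfolding eventually_at by (rule exI[of _ "1/2"]) (auto simp: dist_real_def)
        have "\<forall>\<^sub>F y in at 0 within {0..1}. a < Re (?g y)" by (rule near) (simp add: g)
        with e show ?thesis
        proof eventually_elim
          case (elim y)
          then have "0 < sin (2 * pi * y)" by (intro sin_gt_zero) auto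
          then show ?case using elim R c[of "?g y"] by (auto simp: \<Phi>_def) (simp add: g)
        qed
      qed
      moreover have "((\<lambda>y. G (?g y) + c) \<longlongrightarrow> G (of_real R) + c) (at 0 within {0..1})"
        using gG[of 0 "{0..1}"] by (auto simp: continuous_within g intro!: tendsto_intros)
      ultimately have "(\<Phi> \<longlongrightarrow> G (of_real R) + c) (at 0 within {0..1})"
        by (rule Lim_transform_eventually[rotated])
      then show ?thesis using 1 by (simp add: continuous_within \<Phi>_def)
    next
      case 2
      have "\<forall>\<^sub>F y in at 1 within {0..1}. G (?g y) + d = \<Phi> y"
      proof -
        have e: "\<forall>\<^sub>F y in at (1::real) within {0..1}. 1/2 < y \<and> y < 1"
          unfolding eventually_at by (rule exI[of _ "1/2"]) (auto simp: dist_real_def)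
        have "\<forall>\<^sub>F y in at 1 within {0..1}. a < Re (?g y)" by (rule near) (simp add: g)
        with e show ?thesis
        proof eventually_elim
          case (elim y)
          then have "pi < 2 * pi * y" "2 * pi * y < 2 * pi" by auto
          then have "sin (2 * pi * y) < 0" by (rule sin_lt_zero)
          then show ?case using elim R d[of "?g y"] by (auto simp: \<Phi>_def mult_less_0_iff) (simp add: g mult_less_0_iff)
        qed
      qed
      moreover have "((\<lambda>y. G (?g y) + d) \<longlongrightarrow> G (of_real R) + d) (at 1 within {0..1})"
        using gG[of 1 "{0..1}"] by (auto simp: continuous_within g intro!: tendsto_intros)
      ultimately have "(\<Phi> \<longlongrightarrow> G (of_real R) + d) (at 1 within {0..1})"
        by (rule Lim_transform_eventually[rotated])
      then show ?thesis using 2 by (simp add: continuous_within \<Phi>_def)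
    next
      case 3
      have "isCont (\<lambda>x. F (?g x)) x"
        using 3 by (intro continuous_within_compose3[OF _ gc] DERIV_isCont[OF F] gS)
      moreover have "\<forall>\<^sub>F y in nhds x. \<Phi> y = F (?g y)"
        using 3 eventually_nhds_in_open[of "{0<..<1}" x] by (auto elim!: eventually_mono simp: \<Phi>_def)
      ultimately have "isCont \<Phi> x" by (simp add: isCont_cong)
      then show ?thesis by (rule continuous_at_imp_continuous_at_within)
    qed
  qed
  have "((\<lambda>x. f (?g x) * vector_derivative ?g (at x)) has_integral (\<Phi> 1 - \<Phi> 0)) {0..1}"
  proof (rule fundamental_theorem_of_calculus_interior[OF _ cont])
    fix x :: real assume x: "x \<in> {0<..<1}"
    have "((\<lambda>x. F (?g x)) has_vector_derivative vector_derivative ?g (at x) * f (?g x)) (at x)"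
      using x field_vector_diff_chain_at[where f = ?g and g = F, OF has_vector_derivative_circlepath F[OF gS]]
      by (auto simp: o_def vector_derivative_circlepath)
    then have "(\<Phi> has_vector_derivative vector_derivative ?g (at x) * f (?g x)) (at x)"
      by (rule has_vector_derivative_transform_within_open[of _ _ _ "{0<..<1}"]) (use x in \<open>auto simp: \<Phi>_def\<close>)
    then show "(\<Phi> has_vector_derivative f (?g x) * vector_derivative ?g (at x)) (at x)"
      by (simp add: mult.commute)
  qed simp
  then show ?thesis
    by (simp add: has_contour_integral \<Phi>_def)
qed

text \<open>One pair of primitives serves every radius beyond \<open>a\<close>, and the jump d - c
  does not depend on the radius.\<close>

lemma contour_integral_circlepath_radius_indep:
  assumes "f holomorphic_on - \<real>\<^sub>\<ge>\<^sub>0" and "f holomorphic_on {z. a < Re z}"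
    and "0 < R" "a < R" "0 < R'" "a < R'"
  shows "contour_integral (circlepath 0 R) f = contour_integral (circlepath 0 R') f"
proof -
  obtain F G c d where *:
    "\<And>z. z \<in> - \<real>\<^sub>\<ge>\<^sub>0 \<Longrightarrow> (F has_field_derivative f z) (at z)"
    "\<And>z. a < Re z \<Longrightarrow> (G has_field_derivative f z) (at z)"
    "\<And>z. a < Re z \<Longrightarrow> 0 < Im z \<Longrightarrow> F z = G z + c"
    "\<And>z. a < Re z \<Longrightarrow> Im z < 0 \<Longrightarrow> F z = G z + d"
    using slit_primitives[OF assms(1,2)] by blast
  show ?thesis
    using circlepath_slit_primitives[OF * assms(3,4)] circlepath_slit_primitives[OF * assms(5,6)]
    by (simp add: contour_integral_unique)
qed

text \<open>Both points are moved to the right by \<open>x\<close>. Each move costs at most exp(-r),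
  the integral of the bound along a ray, and the segment joining the moved points costs exp(-r-x)
  times its length, which vanishes as \<open>x\<close> grows. Thus the distance of the points, which
  is not under control on the tails of the contour, drops out.\<close>

lemma norm_primitive_diff_right_le:
  assumes G: "\<And>z. a < Re z \<Longrightarrow> (G has_field_derivative f z) (at z)"
    and le: "\<And>z. a < Re z \<Longrightarrow> norm (f z) \<le> exp (- Re z)"
    and r: "a < r" "r \<le> Re z" "r \<le> Re w"
  shows "norm (G z - G w) \<le> 2 * exp (- r)"
proof -
  have horiz: "norm (G (z + of_real x) - G z) \<le> exp (- r)" if "r \<le> Re z" "0 < x" for z x
  proof -
    have "norm (G (z + of_real x) - G (z + of_real 0)) \<le> - exp (- (Re z + x)) - (- exp (- (Re z + 0)))"
    proof (rule differentiable_bound_general[OF that(2)])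
      have *: "((\<lambda>x. G (z + of_real x)) has_vector_derivative f (z + of_real t)) (at t)" if "0 \<le> t" for t
      proof -
        have "((\<lambda>x. z + of_real x) has_vector_derivative 1) (at t)"
          by (auto intro!: derivative_eq_intros simp: has_vector_derivative_of_real)
        from field_vector_diff_chain_at[OF this G] show ?thesis
          using that \<open>r \<le> Re z\<close> r(1) by (simp add: o_def)
      qed
      then show "continuous_on {0..x} (\<lambda>x. G (z + of_real x))"
        by (intro continuous_at_imp_continuous_on ballI has_vector_derivative_continuous) auto
      show "((\<lambda>x. G (z + of_real x)) has_vector_derivative f (z + of_real t)) (at t)"
        if "0 < t" for t using that * by simp
      show "((\<lambda>t. - exp (- (Re z + t))) has_vector_derivative exp (- (Re z + t))) (at t)" for t
        unfolding has_real_derivative_iff_has_vector_derivative[symmetric]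
        by (auto intro!: derivative_eq_intros)
      show "norm (f (z + of_real t)) \<le> exp (- (Re z + t))" if "0 < t" for t
        using le[of "z + of_real t"] that \<open>r \<le> Re z\<close> r(1) by simp
    qed (intro continuous_intros)
    also have "\<dots> \<le> exp (- Re z)" by simp
    also have "\<dots> \<le> exp (- r)" using that by simp
    finally show ?thesis by simp
  qed
  have vert: "norm (G (z + of_real x) - G (w + of_real x)) \<le> exp (- x) * (exp (- r) * norm (z - w))" if "0 < x" for x
  proof -
    let ?C = "closed_segment (z + of_real x) (w + of_real x)"
    have Re: "r + x \<le> Re u" if "u \<in> ?C" for u
    proof -
      have "?C \<subseteq> {u. r + x \<le> Re u}"
        using r convex_halfspace_Re_ge by (intro closed_segment_subset) auto
      then show ?thesis using that by auto
    qed
    have "norm (G (z + of_real x) - G (w + of_real x)) \<le> exp (- r - x) * norm ((z + of_real x) - (w + of_real x))"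
    proof (rule field_differentiable_bound[where S = ?C and f' = f])
      show "(G has_field_derivative f u) (at u within ?C)" if "u \<in> ?C" for u
        using Re[OF that] r \<open>0 < x\<close> by (intro has_field_derivative_at_within[OF G]) auto
      show "norm (f u) \<le> exp (- r - x)" if "u \<in> ?C" for u
        using Re[OF that] r \<open>0 < x\<close> by (intro order_trans[OF le]) auto
    qed auto
    then show ?thesis by (simp add: exp_diff exp_minus field_simps)
  qed
  have "\<forall>\<^sub>F x in at_top. norm (G z - G w) \<le> 2 * exp (- r) + exp (- x) * (exp (- r) * norm (z - w))"
    using eventually_gt_at_top[of 0]
  proof eventually_elim
    case (elim x)
    have "norm (G z - G w) \<le> norm (G (z + of_real x) - G z) + norm (G (z + of_real x) - G (w + of_real x))
        + norm (G (w + of_real x) - G w)"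
      by norm
    then show ?case using horiz[OF r(2) elim] horiz[OF r(3) elim] vert[OF elim] by linarith
  qed
  moreover have "((\<lambda>x. 2 * exp (- r) + exp (- x) * (exp (- r) * norm (z - w))) \<longlongrightarrow> 2 * exp (- r) + 0 * (exp (- r) * norm (z - w))) at_top"
    by (intro tendsto_intros filterlim_compose[OF exp_at_bot] filterlim_uminus_at_bot_at_top)
  ultimately have "norm (G z - G w) \<le> 2 * exp (- r) + 0 * (exp (- r) * norm (z - w))"
    by (intro tendsto_lowerbound[OF _ _ trivial_limit_at_top_linorder])
  then show ?thesis by simp
qed

text \<open>On a bounded interval the integral is an increment of \<open>F\<close>. If the ends lie
  far to the right, one above and one below the axis, it is d - c up to an increment of
  \<open>G\<close>, which is exponentially small. Since the integral over the line is a limit over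
  intervals containing a large ball, this estimate is already convergence.\<close>

lemma has_integral_encircling:
  assumes g: "encircles_nonneg_axis \<gamma>"
    and f: "f holomorphic_on - \<real>\<^sub>\<ge>\<^sub>0" "f holomorphic_on {z. a < Re z}"
    and le: "\<And>z. a < Re z \<Longrightarrow> norm (f z) \<le> exp (- Re z)"
    and R: "0 < R" "a < R"
  shows "((\<lambda>u. f (\<gamma> u) * vector_derivative \<gamma> (at u)) has_integral contour_integral (circlepath 0 R) f) UNIV"
proof -
  obtain F G c d where *:
    "\<And>z. z \<in> - \<real>\<^sub>\<ge>\<^sub>0 \<Longrightarrow> (F has_field_derivative f z) (at z)"
    "\<And>z. a < Re z \<Longrightarrow> (G has_field_derivative f z) (at z)"
    "\<And>z. a < Re z \<Longrightarrow> 0 < Im z \<Longrightarrow> F z = G z + c"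
    "\<And>z. a < Re z \<Longrightarrow> Im z < 0 \<Longrightarrow> F z = G z + d"
    using slit_primitives[OF f] by blast
  have circle: "contour_integral (circlepath 0 R) f = d - c"
    using circlepath_slit_primitives[OF * R] by (rule contour_integral_unique)
  have fin: "((\<lambda>u. f (\<gamma> u) * vector_derivative \<gamma> (at u)) has_integral (F (\<gamma> q) - F (\<gamma> p))) {p..q}" if "p < q" for p q
  proof -
    have "((\<lambda>u. f (\<gamma> u) * vector_derivative \<gamma> (at u within {p..q})) has_integral (F (\<gamma> q) - F (\<gamma> p))) {p..q}"
    proof (rule contour_integral_primitive_lemma[where S = "- \<real>\<^sub>\<ge>\<^sub>0"])
      show "\<gamma> piecewise_differentiable_on {p..q}"
        using g that by (auto simp: encircles_nonneg_axis_def intro: piecewise_C1_imp_differentiable)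
      show "\<gamma> x \<in> - \<real>\<^sub>\<ge>\<^sub>0" for x
        using g by (simp add: encircles_nonneg_axis_def disjoint_iff)
    qed (use that in \<open>auto intro: has_field_derivative_at_within *(1)\<close>)
    \<comment> \<open>The derivative within the interval and the two-sided one can differ only at
      the two end points.\<close>
    then show ?thesis
      by (rule has_integral_spike_finite[of "{p, q}", rotated 2])
        (auto simp: vector_derivative_at_within_ivl[symmetric] at_within_Icc_at)
  qed
  show ?thesis
    unfolding circle
  proof (subst has_integral_alt, intro if_not_P[THEN iffD2] allI impI)
    show "\<nexists>a b. (UNIV :: real set) = cbox a b"
      using not_compact_UNIV[where 'a=real] compact_cbox by metis
    fix e :: real assume "0 < e"
    have "((\<lambda>r. 2 * exp (- r)) \<longlongrightarrow> 2 * 0) (at_top :: real filter)"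
      by (intro tendsto_intros filterlim_compose[OF exp_at_bot] filterlim_uminus_at_bot_at_top)
    then have "\<forall>\<^sub>F r in at_top. 2 * exp (- r) < e"
      using \<open>0 < e\<close> by (auto dest: order_tendstoD)
    moreover have "\<forall>\<^sub>F r in at_top. a < (r :: real)" by (rule eventually_gt_at_top)
    ultimately obtain r where r: "2 * exp (- r) < e" "a < r"
      using eventually_happens'[OF trivial_limit_at_top_linorder] eventually_conj by (metis (no_types, lifting))
    have "\<forall>\<^sub>F u in at_bot. r \<le> Re (\<gamma> u) \<and> 0 < Im (\<gamma> u)"
      using g by (auto simp: encircles_nonneg_axis_def filterlim_at_top eventually_conj_iff)
    then obtain p where p: "\<And>u. u \<le> p \<Longrightarrow> r \<le> Re (\<gamma> u) \<and> 0 < Im (\<gamma> u)"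
      by (auto simp: eventually_at_bot_linorder)
    have "\<forall>\<^sub>F u in at_top. r \<le> Re (\<gamma> u) \<and> Im (\<gamma> u) < 0"
      using g by (auto simp: encircles_nonneg_axis_def filterlim_at_top eventually_conj_iff)
    then obtain q where q: "\<And>u. q \<le> u \<Longrightarrow> r \<le> Re (\<gamma> u) \<and> Im (\<gamma> u) < 0"
      by (auto simp: eventually_at_top_linorder)
    \<comment> \<open>Every box containing this ball contains \<open>p\<close> and \<open>q\<close>.
      The extra 1 makes the box nondegenerate, as it then contains both B - 1/2 > 0 and its
      negative.\<close>
    define B where "B = \<bar>p\<bar> + \<bar>q\<bar> + 1"
    have "\<exists>z. ((\<lambda>u. if u \<in> UNIV then f (\<gamma> u) * vector_derivative \<gamma> (at u) else 0) has_integral z) (cbox b b') \<and> norm (z - (d - c)) < e"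
      if "ball 0 B \<subseteq> cbox b b'" for b b'
    proof -
      have "p \<in> ball 0 B" "q \<in> ball 0 B" "B - 1/2 \<in> ball 0 B" "- (B - 1/2) \<in> ball 0 B"
        by (auto simp: B_def dist_real_def)
      then have "p \<in> cbox b b'" "q \<in> cbox b b'" "B - 1/2 \<in> cbox b b'" "- (B - 1/2) \<in> cbox b b'"
        using that by blast+
      then have bb: "b \<le> p" "q \<le> b'" "b < b'"
        by (auto simp: B_def)
      have "F (\<gamma> b') - F (\<gamma> b) - (d - c) = G (\<gamma> b') - G (\<gamma> b)"
        using *(3)[of "\<gamma> b"] *(4)[of "\<gamma> b'"] p[OF bb(1)] q[OF bb(2)] r(2) by simp
      moreover have "norm (G (\<gamma> b') - G (\<gamma> b)) \<le> 2 * exp (- r)"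
        using p[OF bb(1)] q[OF bb(2)] r(2) by (intro norm_primitive_diff_right_le[OF *(2) le]) auto
      ultimately show ?thesis
        using fin[OF bb(3)] r(1) by (intro exI[of _ "F (\<gamma> b') - F (\<gamma> b)"]) simp
    qed
    then show "\<exists>B>0. \<forall>b b'. ball 0 B \<subseteq> cbox b b' \<longrightarrow>
      (\<exists>z. ((\<lambda>u. if u \<in> UNIV then f (\<gamma> u) * vector_derivative \<gamma> (at u) else 0) has_integral z) (cbox b b') \<and> norm (z - (d - c)) < e)"
      by (intro exI[of _ B]) (auto simp: B_def)
  qed
qed

section \<open>Means over circles and resolvents\<close>

text \<open>The second factor is the velocity divided by 2 pi i, so this is a contour integral with
  1/(2 pi i) built in. As an integral over [0,1] it falls under the theorems on continuous
  dependence and interchange over compact boxes.\<close>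

definition circle_mean :: "real \<Rightarrow> (complex \<Rightarrow> complex) \<Rightarrow> complex" where
  "circle_mean R f = integral {0..1} (\<lambda>t. f (circlepath 0 R t) * circlepath 0 R t)"

lemma contour_integral_circle_mean:
  "contour_integral (circlepath 0 R) f = 2 * of_real pi * \<i> * circle_mean R f"
proof -
  have "vector_derivative (circlepath 0 R) (at t) = 2 * of_real pi * \<i> * circlepath 0 R t" for t
    unfolding vector_derivative_circlepath by (simp add: circlepath)
  then have "contour_integral (circlepath 0 R) f
      = integral {0..1} (\<lambda>t. (2 * of_real pi * \<i>) * (f (circlepath 0 R t) * circlepath 0 R t))"
    by (simp add: contour_integral_integral mult_ac)
  then show ?thesis by (simp add: circle_mean_def)
qed

lemma norm_circlepath_0: "norm (circlepath 0 R t) = \<bar>R\<bar>"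
  by (simp add: circlepath norm_mult)

lemma continuous_on_circlepath_0 [continuous_intros]:
  "continuous_on S f \<Longrightarrow> continuous_on S (\<lambda>x. circlepath 0 R (f x))"
  unfolding circlepath by (intro continuous_intros)

lemma circle_mean_cong:
  assumes "\<And>z. norm z = \<bar>R\<bar> \<Longrightarrow> f z = g z"
  shows "circle_mean R f = circle_mean R g"
  unfolding circle_mean_def by (simp add: assms norm_circlepath_0)

lemma circle_mean_integrable:
  assumes "continuous_on (sphere 0 \<bar>R\<bar>) f"
  shows "(\<lambda>t. f (circlepath 0 R t) * circlepath 0 R t) integrable_on {0..1}"
proof (rule integrable_continuous_real)
  show "continuous_on {0..1} (\<lambda>t. f (circlepath 0 R t) * circlepath 0 R t)"
    by (intro continuous_intros continuous_on_compose2[OF assms]) (auto simp: norm_circlepath_0)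
qed

lemma circle_mean_diff:
  assumes "continuous_on (sphere 0 \<bar>R\<bar>) f" "continuous_on (sphere 0 \<bar>R\<bar>) g"
  shows "circle_mean R (\<lambda>z. f z - g z) = circle_mean R f - circle_mean R g"
  using assms[THEN circle_mean_integrable]
  by (simp add: circle_mean_def left_diff_distrib integral_diff)

lemma circle_mean_cmult: "circle_mean R (\<lambda>z. c * f z) = c * circle_mean R f"
  by (simp add: circle_mean_def mult.assoc)

lemma circle_mean_sum:
  assumes "finite A" "\<And>k. k \<in> A \<Longrightarrow> continuous_on (sphere 0 \<bar>R\<bar>) (f k)"
  shows "circle_mean R (\<lambda>z. \<Sum>k\<in>A. f k z) = (\<Sum>k\<in>A. circle_mean R (f k))"
  using assms circle_mean_integrable
  by (simp add: circle_mean_def sum_distrib_right integral_sum)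

lemma continuous_on_circle_mean:
  assumes "continuous_on (S \<times> sphere 0 \<bar>R\<bar>) (\<lambda>(w, z). K w z)"
  shows "continuous_on S (\<lambda>w. circle_mean R (K w))"
proof -
  have "continuous_on (S \<times> cbox 0 1) (\<lambda>(w, t). K w (circlepath 0 R t) * circlepath 0 R t)"
    unfolding case_prod_unfold
    by (intro continuous_intros continuous_on_compose2[OF assms[unfolded case_prod_unfold],
          of _ "\<lambda>p. (fst p, circlepath 0 R (snd p))", simplified])
      (auto simp: norm_circlepath_0)
  from integral_continuous_on_param[OF this] show ?thesis
    by (simp add: circle_mean_def)
qed

lemma circle_mean_swap:
  fixes a b :: real
  assumes "continuous_on ({a..b} \<times> sphere 0 \<bar>R\<bar>) (\<lambda>(w, z). K w z)"
  shows "integral {a..b} (\<lambda>w. circle_mean R (K w)) = circle_mean R (\<lambda>z. integral {a..b} (\<lambda>w. K w z))"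
proof -
  have box: "cbox (a, 0) (b, 1) = {a..b} \<times> {0..1::real}"
    by (simp add: cbox_Pair_eq)
  have "continuous_on (cbox (a, 0) (b, 1)) (\<lambda>(w, t). K w (circlepath 0 R t) * circlepath 0 R t)"
    unfolding case_prod_unfold box
    by (intro continuous_intros continuous_on_compose2[OF assms[unfolded case_prod_unfold],
          of _ "\<lambda>p. (fst p, circlepath 0 R (snd p))", simplified])
      (auto simp: norm_circlepath_0)
  from integral_swap_continuous[OF this] show ?thesis
    by (simp add: circle_mean_def)
qed

text \<open>The value does not change with the radius, while the length of the circle grows linearly
  and \<open>f\<close> decays quadratically; so it is bounded by a multiple of 1/\<rho> for all
  large \<rho>.\<close>

lemma circle_mean_eq_0:
  assumes f: "f holomorphic_on - \<real>\<^sub>\<ge>\<^sub>0" "f holomorphic_on {z. a < Re z}"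
    and R: "0 < R" "a < R"
    and le: "\<forall>\<^sub>F \<rho> in at_top. \<forall>z. norm z = \<rho> \<longrightarrow> norm (f z) \<le> C / \<rho>\<^sup>2"
  shows "circle_mean R f = 0"
proof -
  have "\<forall>\<^sub>F \<rho> in at_top. norm (circle_mean R f) \<le> \<bar>C\<bar> / \<rho>"
    using le eventually_gt_at_top[of 0] eventually_gt_at_top[of a]
  proof eventually_elim
    case (elim \<rho>)
    have eq: "circle_mean R f = circle_mean \<rho> f"
      using contour_integral_circlepath_radius_indep[OF f R elim(2,3)]
      by (simp add: contour_integral_circle_mean)
    have "norm (circle_mean \<rho> f) \<le> \<bar>C\<bar> / \<rho> * (1 - 0)"
      unfolding circle_mean_def
    proof (rule integral_bound)
      \<comment> \<open>The circle meets the slit only at \<rho> itself, which lies in the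
        half-plane.\<close>
      have "sphere 0 \<bar>\<rho>\<bar> \<subseteq> - \<real>\<^sub>\<ge>\<^sub>0 \<union> {z. a < Re z}"
        using elim(2,3) by (auto simp: complex_nonneg_Reals_iff cmod_eq_Re)
      moreover have "continuous_on (- \<real>\<^sub>\<ge>\<^sub>0 \<union> {z. a < Re z}) f"
        by (intro continuous_on_open_Un f[THEN holomorphic_on_imp_continuous_on]
            open_halfspace_Re_gt open_Compl closed_nonneg_Reals_complex)
      ultimately have c: "continuous_on (sphere 0 \<bar>\<rho>\<bar>) f" by (rule continuous_on_subset[rotated])
      show "continuous_on {0..1} (\<lambda>t. f (circlepath 0 \<rho> t) * circlepath 0 \<rho> t)"
        by (intro continuous_intros continuous_on_compose2[OF c]) (auto simp: norm_circlepath_0)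
      fix t
      have "norm (f (circlepath 0 \<rho> t)) \<le> C / \<rho>\<^sup>2"
        using elim(1,2) by (simp add: norm_circlepath_0)
      also have "\<dots> \<le> \<bar>C\<bar> / \<rho>\<^sup>2" by (simp add: divide_right_mono)
      finally show "norm (f (circlepath 0 \<rho> t) * circlepath 0 \<rho> t) \<le> \<bar>C\<bar> / \<rho>"
        using elim(2) by (simp add: norm_mult norm_circlepath_0 field_simps power2_eq_square)
    qed simp
    then show ?case by (simp add: eq)
  qed
  moreover have "((\<lambda>\<rho>. \<bar>C\<bar> / \<rho>) \<longlongrightarrow> 0) at_top"
    by (intro tendsto_divide_0[OF tendsto_const] filterlim_at_top_imp_at_infinity filterlim_ident)
  ultimately have "norm (circle_mean R f) \<le> 0"
    by (intro tendsto_lowerbound[OF _ _ trivial_limit_at_top_linorder])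
  then show ?thesis by simp
qed

text \<open>Repeated integration by parts, packaged as an explicit primitive -E S where
  \<open>S\<close> obeys a recursion in \<open>m\<close>. The end w = 0 contributes the power of the
  inverse, the end w = r the sum with its factor exp(-ra).\<close>

lemma integral_monomial_exp:
  fixes a :: complex
  assumes "a \<noteq> 0" "0 \<le> r"
  shows "((\<lambda>w. of_real (w ^ m / fact m) * exp (- (of_real w * a))) has_integral
     (inverse a ^ Suc m - exp (- (of_real r * a)) * (\<Sum>k\<le>m. of_real (r ^ k / fact k) * inverse a ^ Suc (m - k)))) {0..r}"
proof -
  define p where "p m w = (of_real (w ^ m / fact m) :: complex)" for m and w :: real
  define E where "E w = exp (- (of_real w * a))" for w :: real
  define S where "S m w = (\<Sum>k\<le>m. p k w * inverse a ^ Suc (m - k))" for m w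
  have S_Suc: "S (Suc m) w = inverse a * (S m w + p (Suc m) w)" for m w
    by (simp add: S_def sum_distrib_left Suc_diff_le algebra_simps)
  have dp: "(p (Suc m) has_vector_derivative p m w) (at w)" for m w
  proof -
    have "((\<lambda>w. w ^ Suc m / fact (Suc m)) has_real_derivative w ^ m / fact m) (at w)"
      using DERIV_cdivide[OF DERIV_pow[of "Suc m" w], of "fact (Suc m)"] by (simp del: of_nat_Suc)
    then show ?thesis
      unfolding p_def by (rule has_vector_derivative_of_real)
  qed
  have dE: "(E has_vector_derivative - a * E w) (at w)" for w
    unfolding E_def by (rule has_vector_derivative_real_field) (auto intro!: derivative_eq_intros)
  have der: "((\<lambda>w. - (E w * S m w)) has_vector_derivative p m w * E w) (at w)" for w
  proof (induction m)
    case 0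
    have "((\<lambda>w. - inverse a * E w) has_vector_derivative - inverse a * (- a * E w)) (at w)"
      by (intro has_vector_derivative_mult_right dE)
    moreover have "- inverse a * (- a * E w) = E w"
      using \<open>a \<noteq> 0\<close> by simp
    ultimately have "((\<lambda>w. - inverse a * E w) has_vector_derivative E w) (at w)"
      by (simp only:)
    then show ?case by (simp add: S_def p_def mult.commute)
  next
    case (Suc m)
    have "((\<lambda>w. inverse a * (- (E w * S m w) - E w * p (Suc m) w)) has_vector_derivative
      inverse a * (p m w * E w - (E w * p m w + - a * E w * p (Suc m) w))) (at w)"
      by (intro has_vector_derivative_mult_right has_vector_derivative_diff has_vector_derivative_mult Suc dE dp)
    moreover have "inverse a * (p m w * E w - (E w * p m w + - a * E w * p (Suc m) w)) = p (Suc m) w * E w"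
      using \<open>a \<noteq> 0\<close> by (simp add: field_simps)
    moreover have "inverse a * (- (E w * S m w) - E w * p (Suc m) w) = - (E w * S (Suc m) w)" for w
      unfolding S_Suc by (simp add: algebra_simps)
    ultimately show ?case by (simp only:)
  qed
  have "((\<lambda>w. p m w * E w) has_integral (- (E r * S m r) - - (E 0 * S m 0))) {0..r}"
    by (rule fundamental_theorem_of_calculus[OF assms(2)]) (rule has_vector_derivative_at_within[OF der])
  moreover have "S m 0 = inverse a ^ Suc m"
  proof -
    have "S m 0 = (\<Sum>k\<le>m. if k = 0 then inverse a ^ Suc m else 0)"
      unfolding S_def p_def by (intro sum.cong) auto
    then show ?thesis by simp
  qed
  moreover have "E 0 = 1" by (simp add: E_def)
  ultimately have "((\<lambda>w. p m w * E w) has_integral (inverse a ^ Suc m - E r * S m r)) {0..r}"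
    by simp
  then show ?thesis unfolding E_def S_def p_def .
qed

section \<open>Products of resolvents and their decay\<close>

definition resolvents :: "nat \<Rightarrow> (nat \<Rightarrow> nat) \<Rightarrow> (nat \<Rightarrow> real) \<Rightarrow> complex \<Rightarrow> complex" where
  "resolvents n \<alpha> q z = (\<Prod>j\<le>n. inverse (of_real (q j) - z) ^ \<alpha> j)"

lemma resolvents_Suc:
  "resolvents (Suc n) \<alpha> q z = resolvents n \<alpha> q z * inverse (of_real (q (Suc n)) - z) ^ \<alpha> (Suc n)"
  by (simp add: resolvents_def)

lemma holomorphic_on_resolvents:
  assumes "\<And>j. j \<le> n \<Longrightarrow> of_real (q j) \<notin> S"
  shows "resolvents n \<alpha> q holomorphic_on S"
  unfolding resolvents_def using assms
  by (intro holomorphic_intros) (metis atMost_iff eq_iff_diff_eq_0)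

lemma continuous_on_resolvents [continuous_intros]:
  assumes "\<And>j. j \<le> n \<Longrightarrow> of_real (q j) \<notin> f ` S" "continuous_on S f"
  shows "continuous_on S (\<lambda>x. resolvents n \<alpha> q (f x))"
  unfolding resolvents_def using assms
  by (intro continuous_intros) (auto simp: image_iff)

text \<open>From \<rho> \<ge> 2a + 2 two things follow: each pole is at distance at least \<rho>/2
  from \<open>z\<close>, and 2/\<rho> is at most 1, so that the total exponent may be lowered to
  2.\<close>

lemma norm_resolvents_le:
  assumes q: "\<And>j. j \<le> n \<Longrightarrow> 0 \<le> q j \<and> q j \<le> a" and \<rho>: "norm z = \<rho>" "2 * a + 2 \<le> \<rho>" "0 \<le> a"
    and \<alpha>: "2 \<le> (\<Sum>j\<le>n. \<alpha> j)"
  shows "norm (resolvents n \<alpha> q z) \<le> 4 / \<rho>\<^sup>2"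
proof -
  have "norm (inverse (of_real (q j) - z)) \<le> 2 / \<rho>" if "j \<le> n" for j
  proof -
    have "\<rho> / 2 \<le> norm z - norm (of_real (q j) :: complex)"
      using q[OF that] \<rho> by auto
    also have "\<dots> \<le> norm (of_real (q j) - z)"
      by (metis norm_minus_commute norm_triangle_ineq2)
    finally show ?thesis
      using \<rho> le_imp_inverse_le[of "\<rho> / 2"] by (simp add: norm_inverse)
  qed
  then have "norm (resolvents n \<alpha> q z) \<le> (\<Prod>j\<le>n. (2 / \<rho>) ^ \<alpha> j)"
    unfolding resolvents_def prod_norm[symmetric] norm_power
    by (intro prod_mono) (auto intro!: power_mono)
  also have "\<dots> = (2 / \<rho>) ^ (\<Sum>j\<le>n. \<alpha> j)"
    by (simp add: power_sum)
  also have "\<dots> \<le> (2 / \<rho>) ^ 2"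
    using \<rho> \<alpha> by (intro power_decreasing) auto
  finally show ?thesis by (simp add: power_divide)
qed

text \<open>Total order 2 is exactly what beats the growing circumference; a single simple pole
  would leave a nonzero residue.\<close>

lemma circle_mean_resolvents_eq_0:
  assumes q: "\<And>j. j \<le> n \<Longrightarrow> 0 \<le> q j \<and> q j \<le> a" and R: "0 \<le> a" "a < R"
    and \<alpha>: "2 \<le> (\<Sum>j\<le>n. \<alpha> j)"
  shows "circle_mean R (resolvents n \<alpha> q) = 0"
proof (rule circle_mean_eq_0)
  show "resolvents n \<alpha> q holomorphic_on - \<real>\<^sub>\<ge>\<^sub>0"
    using q by (intro holomorphic_on_resolvents) (auto simp: complex_nonneg_Reals_iff)
  show "resolvents n \<alpha> q holomorphic_on {z. a < Re z}"
    using q by (intro holomorphic_on_resolvents) (auto simp: not_less)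
  have "\<forall>\<^sub>F \<rho> in at_top. 2 * a + 2 \<le> (\<rho>::real)" by (rule eventually_ge_at_top)
  then show "\<forall>\<^sub>F \<rho> in at_top. \<forall>z. norm z = \<rho> \<longrightarrow> norm (resolvents n \<alpha> q z) \<le> 4 / \<rho>\<^sup>2"
    by eventually_elim (use norm_resolvents_le[OF q _ _ R(1) \<alpha>] in auto)
qed (use R in auto)

text \<open>A Gamma density up to scaling: for m > 0 and Re z < q its Laplace transform at -z is (q
  - z)^(-m), which fixes the factor 1/(m-1)!. The cut-off at negative \<open>v\<close> lets
  integrals over the simplex be written without specifying a domain.\<close>

definition exp_monomial :: "nat \<Rightarrow> real \<Rightarrow> real \<Rightarrow> real" where
  "exp_monomial m q v = (if 0 \<le> v then v ^ (m - 1) * exp (- (v * q)) / fact (m - 1) else 0)"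

lemma exp_monomial_nonneg: "0 \<le> exp_monomial m q v"
  by (simp add: exp_monomial_def)

lemma borel_measurable_exp_monomial [measurable]: "exp_monomial m q \<in> borel_measurable borel"
  unfolding exp_monomial_def by measurable

lemma continuous_on_exp_monomial: "continuous_on {0..} (exp_monomial m q)"
proof -
  have "continuous_on {0..} (\<lambda>v. v ^ (m - 1) * exp (- (v * q)) / fact (m - 1))"
    by (intro continuous_intros) simp
  then show ?thesis by (rule continuous_on_eq) (simp add: exp_monomial_def)
qed

text \<open>Integrating over \<open>v\<close> first yields the resolvent power and boundary terms; the latter carry no
  factor $e^{-rz}$ and are $O(|z|^{-2})$, so they vanish when the circle grows.\<close>

lemma circle_mean_resolvents_Suc:
  assumes q: "\<And>j. j \<le> Suc n \<Longrightarrow> 0 \<le> q j \<and> q j \<le> a" and R: "0 \<le> a" "a < R"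
    and \<alpha>: "\<And>j. j \<le> Suc n \<Longrightarrow> 0 < \<alpha> j" and r: "0 \<le> r"
  shows "circle_mean R (\<lambda>z. exp (- (of_real r * z)) * resolvents (Suc n) \<alpha> q z) =
    integral {0..r} (\<lambda>v. of_real (exp_monomial (\<alpha> (Suc n)) (q (Suc n)) v) *
      circle_mean R (\<lambda>z. exp (- (of_real (r - v) * z)) * resolvents n \<alpha> q z))"
proof -
  define m where "m = \<alpha> (Suc n) - 1"
  have m: "\<alpha> (Suc n) = Suc m" using \<alpha>[of "Suc n"] by (simp add: m_def)
  define x where "x = q (Suc n)"
  have x: "0 \<le> x" "x \<le> a" using q[of "Suc n"] by (auto simp: x_def)
  define b where "b z = inverse (of_real x - z)" for z :: complex
  define A where "A = resolvents n \<alpha> q"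
  have off: "of_real (q j) \<notin> sphere (0::complex) \<bar>R\<bar>" if "j \<le> Suc n" for j
    using q[OF that] R by (auto simp: norm_of_real)
  have x_off: "of_real x - z \<noteq> 0" if "z \<in> sphere 0 \<bar>R\<bar>" for z :: complex
    using off[of "Suc n"] that by (auto simp: x_def)
  have cA: "continuous_on S (\<lambda>x. A (f x))" if "f ` S \<subseteq> sphere 0 \<bar>R\<bar>" "continuous_on S f" for f :: "'a::topological_space \<Rightarrow> complex" and S
    unfolding A_def using that off by (intro continuous_intros) (metis le_SucI subsetD)+
  have cA': "continuous_on (sphere 0 \<bar>R\<bar>) A"
    using cA[of "\<lambda>z. z"] by (simp add: continuous_on_id)
  have cb: "continuous_on (sphere 0 \<bar>R\<bar>) b"
    unfolding b_def using x_off by (intro continuous_intros) auto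
  \<comment> \<open>The exponents -vx and -(r - v)z are regrouped as -v(x - z) and -rz, which makes
    the dependence on \<open>v\<close> that of \<open>integral_monomial_exp\<close>.\<close>
  define K where "K v z = of_real (v ^ m / fact m) * exp (- (of_real v * (of_real x - z))) * (exp (- (of_real r * z)) * A z)"
    for v :: real and z
  have "integral {0..r} (\<lambda>v. of_real (exp_monomial (\<alpha> (Suc n)) (q (Suc n)) v) *
      circle_mean R (\<lambda>z. exp (- (of_real (r - v) * z)) * A z)) = integral {0..r} (\<lambda>v. circle_mean R (K v))"
  proof (rule integral_cong)
    fix v assume v: "v \<in> {0..r}"
    have "of_real (exp_monomial (\<alpha> (Suc n)) (q (Suc n)) v) * (exp (- (of_real (r - v) * z)) * A z) = K v z" for z
    proof -
      have "exp (- (of_real v * (of_real x - z))) * exp (- (of_real r * z))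
          = exp (- (of_real v * of_real x)) * exp (- (of_real (r - v) * z))"
        by (simp add: exp_add[symmetric] algebra_simps)
      then show ?thesis
        using v by (simp add: K_def exp_monomial_def m x_def exp_of_real[symmetric] mult_ac)
    qed
    then show "of_real (exp_monomial (\<alpha> (Suc n)) (q (Suc n)) v) *
      circle_mean R (\<lambda>z. exp (- (of_real (r - v) * z)) * A z) = circle_mean R (K v)"
      by (simp add: circle_mean_cmult[symmetric])
  qed
  also have "\<dots> = circle_mean R (\<lambda>z. integral {0..r} (\<lambda>v. K v z))"
  proof (rule circle_mean_swap)
    show "continuous_on ({0..r} \<times> sphere 0 \<bar>R\<bar>) (\<lambda>(v, z). K v z)"
      unfolding K_def case_prod_unfold by (intro continuous_intros cA) auto
  qed
  also have "\<dots> = circle_mean R (\<lambda>z. exp (- (of_real r * z)) * A z * b z ^ Suc m -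
      (\<Sum>k\<le>m. (exp (- (of_real r * of_real x)) * of_real (r ^ k / fact k)) * (A z * b z ^ Suc (m - k))))"
  proof (rule circle_mean_cong)
    fix z :: complex assume "norm z = \<bar>R\<bar>"
    then have z: "of_real x - z \<noteq> 0" by (intro x_off) simp
    have "integral {0..r} (\<lambda>v. K v z) = (b z ^ Suc m - exp (- (of_real r * (of_real x - z))) *
        (\<Sum>k\<le>m. of_real (r ^ k / fact k) * b z ^ Suc (m - k))) * (exp (- (of_real r * z)) * A z)"
      unfolding K_def b_def
      by (rule integral_unique, rule has_integral_mult_left, rule integral_monomial_exp[OF z r])
    moreover have "exp (- (of_real r * (of_real x - z))) * exp (- (of_real r * z)) = exp (- (of_real r * of_real x))"
      by (simp add: exp_add[symmetric] algebra_simps)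
    moreover have "(B - e * S) * (w * A') = w * A' * B - (e * w) * (S * A')" for B e S w A' :: complex
      by (simp add: algebra_simps)
    ultimately have "integral {0..r} (\<lambda>v. K v z) = exp (- (of_real r * z)) * A z * b z ^ Suc m -
      exp (- (of_real r * of_real x)) * ((\<Sum>k\<le>m. of_real (r ^ k / fact k) * b z ^ Suc (m - k)) * A z)"
      by (simp only:)
    then show "integral {0..r} (\<lambda>v. K v z) = exp (- (of_real r * z)) * A z * b z ^ Suc m -
      (\<Sum>k\<le>m. (exp (- (of_real r * of_real x)) * of_real (r ^ k / fact k)) * (A z * b z ^ Suc (m - k)))"
      by (simp only: sum_distrib_left sum_distrib_right mult_ac)
  qed
  also have "\<dots> = circle_mean R (\<lambda>z. exp (- (of_real r * z)) * A z * b z ^ Suc m) -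
      circle_mean R (\<lambda>z. \<Sum>k\<le>m. (exp (- (of_real r * of_real x)) * of_real (r ^ k / fact k)) * (A z * b z ^ Suc (m - k)))"
    by (intro circle_mean_diff continuous_intros cA' cb)
  also have "circle_mean R (\<lambda>z. \<Sum>k\<le>m. (exp (- (of_real r * of_real x)) * of_real (r ^ k / fact k)) * (A z * b z ^ Suc (m - k))) =
      (\<Sum>k\<le>m. circle_mean R (\<lambda>z. (exp (- (of_real r * of_real x)) * of_real (r ^ k / fact k)) * (A z * b z ^ Suc (m - k))))"
    by (intro circle_mean_sum continuous_intros cA' cb finite_atMost)
  also have "\<dots> = (\<Sum>k\<le>m. (exp (- (of_real r * of_real x)) * of_real (r ^ k / fact k)) * circle_mean R (\<lambda>z. A z * b z ^ Suc (m - k)))"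
    by (simp only: circle_mean_cmult)
  also have "\<dots> = 0"
  proof (intro sum.neutral ballI)
    fix k
    \<comment> \<open>Each boundary term is again a product of resolvents, with m - k + 1 as last
      exponent. All n + 2 exponents are at least 1, so the total order is at least 2.\<close>
    define \<alpha>' where "\<alpha>' = \<alpha>(Suc n := Suc (m - k))"
    have "(\<lambda>z. A z * b z ^ Suc (m - k)) = resolvents (Suc n) \<alpha>' q"
      by (simp add: fun_eq_iff A_def b_def x_def resolvents_def \<alpha>'_def)
    moreover have "circle_mean R (resolvents (Suc n) \<alpha>' q) = 0"
    proof (rule circle_mean_resolvents_eq_0[OF _ R])
      have "(\<Sum>j\<le>n. 1) \<le> (\<Sum>j\<le>n. \<alpha>' j)"
        by (intro sum_mono) (use \<alpha> in \<open>auto simp: \<alpha>'_def Suc_le_eq\<close>)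
      then show "2 \<le> (\<Sum>j\<le>Suc n. \<alpha>' j)" by (simp add: \<alpha>'_def)
    qed (use q in auto)
    ultimately show "exp (- (of_real r * of_real x)) * of_real (r ^ k / fact k) * circle_mean R (\<lambda>z. A z * b z ^ Suc (m - k)) = 0"
      by simp
  qed
  finally show ?thesis
    by (simp add: A_def b_def x_def m resolvents_Suc mult_ac del: power_Suc)
qed

section \<open>Convolutions over the simplex\<close>

lemma deriv_power_exp: "(deriv ^^ k) (\<lambda>z. exp (c * z)) = (\<lambda>z::complex. c ^ k * exp (c * z))"
proof (induction k)
  case (Suc k)
  have "((\<lambda>z. c ^ k * exp (c * z)) has_field_derivative c ^ Suc k * exp (c * z)) (at z)" for z
    by (auto intro!: derivative_eq_intros)
  then show ?case using Suc by (auto intro!: DERIV_imp_deriv)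
qed simp

text \<open>Cauchy's formula for the m-th derivative at the only pole, where the order of the pole
  is m + 1. Turning q - z into z - q gives (-1)^(m+1) and differentiating gives (-r)^m; together
  they leave the one minus sign that every longer convolution inherits.\<close>

lemma circle_mean_resolvents_0:
  assumes q: "0 \<le> q 0" "q 0 < R" and "0 < \<alpha> 0" and r: "0 \<le> r"
  shows "circle_mean R (\<lambda>z. exp (- (of_real r * z)) * resolvents 0 \<alpha> q z) =
    - of_real (exp_monomial (\<alpha> 0) (q 0) r)"
proof -
  obtain m where m: "\<alpha> 0 = Suc m" using \<open>0 < \<alpha> 0\<close> by (cases "\<alpha> 0") auto
  have inv: "inverse (of_real (q 0) - z) ^ Suc m = (- 1) ^ Suc m * (1 / (z - of_real (q 0)) ^ Suc m)" for z :: complex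
  proof -
    have "inverse (of_real (q 0) - z) = - 1 * inverse (z - of_real (q 0))"
      by (metis inverse_minus_eq minus_diff_eq mult_minus1)
    then show ?thesis by (simp only: power_mult_distrib) (simp add: power_inverse divide_simps)
  qed
  have "contour_integral (circlepath 0 R) (\<lambda>z. exp (- of_real r * z) / (z - of_real (q 0)) ^ Suc m)
     = 2 * of_real pi * \<i> * ((- of_real r) ^ m * exp (- of_real r * of_real (q 0))) / fact m"
    by (subst Cauchy_contour_integral_circlepath) (use q in \<open>auto simp: deriv_power_exp[of m "- of_real r", simplified] intro!: continuous_intros holomorphic_intros\<close>)
  then have "circle_mean R (\<lambda>z. exp (- of_real r * z) / (z - of_real (q 0)) ^ Suc m)
     = (- of_real r) ^ m * exp (- of_real r * of_real (q 0)) / fact m"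
    unfolding contour_integral_circle_mean times_divide_eq_right[symmetric]
    by (subst (asm) mult_left_cancel) auto
  moreover have "exp (- (of_real r * z)) * resolvents 0 \<alpha> q z =
     (- 1) ^ Suc m * (exp (- of_real r * z) / (z - of_real (q 0)) ^ Suc m)" for z
    by (simp add: resolvents_def m inv del: power_Suc)
  ultimately have "circle_mean R (\<lambda>z. exp (- (of_real r * z)) * resolvents 0 \<alpha> q z) =
      (- 1) ^ Suc m * ((- of_real r) ^ m * exp (- of_real r * of_real (q 0)) / fact m)"
    by (simp only: circle_mean_cmult)
  also have "\<dots> = ((- 1) ^ Suc m * (- of_real r) ^ m) * exp (- of_real r * of_real (q 0)) / fact m"
    by (simp only: times_divide_eq_right mult.assoc)
  also have "(- 1) ^ Suc m * (- x) ^ m = - (x ^ m)" for x :: complex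
    by (cases "even m") auto
  finally show ?thesis
    using r by (simp add: exp_monomial_def m flip: exp_of_real)
qed

text \<open>Splitting off the last coordinate \<open>v\<close> leaves the same problem with
  \<open>r - v\<close> for \<open>r\<close>, so the induction runs over all r \<ge> 0 although r = 1
  is the goal. A single number \<open>c\<close> carries both claims: as a nonnegative integral the
  simplex side has finiteness as part of the claim, and Tonelli applies without an integrability
  condition.\<close>

lemma simplex_convolution_resolvents:
  assumes q: "\<And>j. j \<le> n \<Longrightarrow> 0 \<le> q j \<and> q j \<le> a" and R: "0 \<le> a" "a < R"
    and \<alpha>: "\<And>j. j \<le> n \<Longrightarrow> 0 < \<alpha> j" and r: "0 \<le> r"
  shows "\<exists>c\<ge>0. (\<integral>\<^sup>+u. ennreal (exp_monomial (\<alpha> 0) (q 0) (r - (\<Sum>j=1..n. u j)) *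
        (\<Prod>j=1..n. exp_monomial (\<alpha> j) (q j) (u j))) \<partial>(Pi\<^sub>M {1..n} (\<lambda>_. lborel))) = ennreal c \<and>
    circle_mean R (\<lambda>z. exp (- (of_real r * z)) * resolvents n \<alpha> q z) = - of_real c"
  using q \<alpha> r
proof (induction n arbitrary: r)
  case 0
  interpret product_sigma_finite "\<lambda>_::nat. lborel :: real measure" ..
  show ?case
    using 0 R
    by (intro exI[of _ "exp_monomial (\<alpha> 0) (q 0) r"]) (simp add: nn_integral_empty circle_mean_resolvents_0 exp_monomial_nonneg del: nn_integral_const)
next
  case (Suc n)
  interpret product_sigma_finite "\<lambda>_::nat. lborel :: real measure" ..
  let ?M = "\<lambda>n. Pi\<^sub>M {1..n} (\<lambda>_::nat. lborel :: real measure)"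
  define F where "F n r u = exp_monomial (\<alpha> 0) (q 0) (r - (\<Sum>j=1..n. u j)) *
        (\<Prod>j=1..n. exp_monomial (\<alpha> j) (q j) (u j))" for n r and u :: "nat \<Rightarrow> real"
  define h where "h n r = circle_mean R (\<lambda>z. exp (- (of_real r * z)) * resolvents n \<alpha> q z)" for n r
  \<comment> \<open>Taken from the circle mean rather than from the simplex integral, because
    continuity in \<open>r\<close> is visible there.\<close>
  define c where "c r = Re (- h n r)" for r
  define g where "g v = exp_monomial (\<alpha> (Suc n)) (q (Suc n)) v" for v
  have [measurable]: "g \<in> borel_measurable borel" by (simp add: g_def[abs_def])
  have meas: "(\<lambda>u. ennreal (F n r u)) \<in> borel_measurable (?M n)" for n r
    unfolding F_def by measurable
  have IH: "0 \<le> c r \<and> (\<integral>\<^sup>+u. ennreal (F n r u) \<partial>?M n) = ennreal (c r) \<and> h n r = - of_real (c r)"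
    if r: "0 \<le> r" for r
  proof -
    have "0 \<le> q j \<and> q j \<le> a" "0 < \<alpha> j" if "j \<le> n" for j
      using Suc.prems(1,2)[of j] that by auto
    from Suc.IH[OF this r] obtain x where
      "0 \<le> x" "(\<integral>\<^sup>+u. ennreal (F n r u) \<partial>?M n) = ennreal x" "h n r = - of_real x"
      unfolding F_def h_def by blast
    then show ?thesis by (simp add: c_def)
  qed
  \<comment> \<open>If the total is negative, so is one of the coordinates and the integrand
    vanishes; this confines \<open>v\<close> to values at most \<open>r\<close>.\<close>
  have neg: "(\<integral>\<^sup>+u. ennreal (F n r u) \<partial>?M n) = 0" if r: "r < 0" for r
  proof -
    have "F n r u = 0" for u
    proof (cases "\<forall>j\<in>{1..n}. 0 \<le> u j")
      case True
      then have "r - (\<Sum>j=1..n. u j) < 0" using r sum_nonneg[of "{1..n}" u] by auto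
      then show ?thesis by (simp add: F_def exp_monomial_def)
    next
      case False
      then show ?thesis by (auto simp: F_def exp_monomial_def intro!: prod_zero bexI)
    qed
    then show ?thesis by simp
  qed
  have cont_h: "continuous_on UNIV (h n)"
    unfolding h_def
  proof (rule continuous_on_circle_mean)
    show "continuous_on (UNIV \<times> sphere 0 \<bar>R\<bar>) (\<lambda>(w, z). exp (- (of_real w * z)) * resolvents n \<alpha> q z)"
    proof -
      have "of_real (q j) \<notin> sphere (0::complex) \<bar>R\<bar>" if "j \<le> n" for j
        using Suc.prems(1)[of j] that R by auto
      then show ?thesis
        unfolding case_prod_unfold by (intro continuous_intros) auto
    qed
  qed
  have cont_c: "continuous_on {0..r} (\<lambda>v. g v * c (r - v))"
    unfolding c_def g_def
    by (intro continuous_intros continuous_on_subset[OF continuous_on_exp_monomial] continuous_on_compose2[OF cont_h]) auto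
  define J where "J = integral {0..r} (\<lambda>v. g v * c (r - v))"
  have hJ: "((\<lambda>v. g v * c (r - v)) has_integral J) {0..r}"
    unfolding J_def by (intro integrable_integral integrable_continuous_real cont_c)
  have "(\<integral>\<^sup>+u. ennreal (F (Suc n) r u) \<partial>?M (Suc n)) =
      (\<integral>\<^sup>+v. \<integral>\<^sup>+u. ennreal (F (Suc n) r (u(Suc n := v))) \<partial>?M n \<partial>lborel)"
  proof -
    have "{1..Suc n} = insert (Suc n) {1..n}" by auto
    then show ?thesis
      using product_nn_integral_insert_rev[of "{1..n}" "Suc n" "\<lambda>u. ennreal (F (Suc n) r u)"] meas[of "Suc n" r] by simp
  qed
  also have "\<dots> = (\<integral>\<^sup>+v. ennreal (g v) * (\<integral>\<^sup>+u. ennreal (F n (r - v) u) \<partial>?M n) \<partial>lborel)"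
  proof (intro nn_integral_cong)
    fix v :: real
    have "F (Suc n) r (u(Suc n := v)) = g v * F n (r - v) u" for u
    proof -
      have "(\<Sum>j=1..n. (u(Suc n := v)) j) = (\<Sum>j=1..n. u j)"
        "(\<Prod>j=1..n. exp_monomial (\<alpha> j) (q j) ((u(Suc n := v)) j)) = (\<Prod>j=1..n. exp_monomial (\<alpha> j) (q j) (u j))"
        by (auto intro!: sum.cong prod.cong)
      then show ?thesis
        by (simp add: F_def g_def algebra_simps)
    qed
    then show "(\<integral>\<^sup>+u. ennreal (F (Suc n) r (u(Suc n := v))) \<partial>?M n) = ennreal (g v) * (\<integral>\<^sup>+u. ennreal (F n (r - v) u) \<partial>?M n)"
      using meas by (simp add: ennreal_mult' g_def exp_monomial_nonneg nn_integral_cmult)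
  qed
  also have "\<dots> = (\<integral>\<^sup>+v. ennreal (indicator {0..r} v * (g v * c (r - v))) \<partial>lborel)"
  proof (intro nn_integral_cong)
    fix v :: real
    consider "v < 0" | "r < v" | "0 \<le> v" "v \<le> r" by linarith
    then show "ennreal (g v) * (\<integral>\<^sup>+u. ennreal (F n (r - v) u) \<partial>?M n) = ennreal (indicator {0..r} v * (g v * c (r - v)))"
    proof cases
      case 1 then show ?thesis by (simp add: g_def exp_monomial_def)
    next
      case 2 then show ?thesis using neg[of "r - v"] by simp
    next
      case 3 then show ?thesis using IH[of "r - v"] by (simp add: ennreal_mult' g_def exp_monomial_nonneg)
    qed
  qed
  also have "\<dots> = ennreal J"
  proof (rule nn_integral_has_integral_lborel)
    have "c \<in> borel_measurable borel"
      unfolding c_def by (intro borel_measurable_continuous_onI continuous_intros continuous_on_subset[OF cont_h]) auto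
    then show "(\<lambda>v. indicator {0..r} v * (g v * c (r - v))) \<in> borel_measurable borel"
      by measurable
    show "0 \<le> indicator {0..r} v * (g v * c (r - v))" for v
      using IH[of "r - v"] by (auto simp: indicator_def g_def exp_monomial_nonneg)
    have "((\<lambda>v. if v \<in> {0..r} then g v * c (r - v) else 0) has_integral J) UNIV"
      using hJ by (simp only: has_integral_restrict_UNIV)
    then show "((\<lambda>v. indicator {0..r} v * (g v * c (r - v))) has_integral J) UNIV"
      by (rule has_integral_eq[rotated]) (auto simp: indicator_def)
  qed
  finally have nn: "(\<integral>\<^sup>+u. ennreal (F (Suc n) r u) \<partial>?M (Suc n)) = ennreal J" .
  have "h (Suc n) r = integral {0..r} (\<lambda>v. of_real (g v) * h n (r - v))"
    unfolding h_def g_def using Suc.prems by (intro circle_mean_resolvents_Suc[OF _ R]) auto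
  also have "\<dots> = integral {0..r} (\<lambda>v. - of_real (g v * c (r - v)))"
    by (intro integral_cong) (use IH in auto)
  also have "\<dots> = - of_real J"
    by (intro integral_unique has_integral_neg has_integral_of_real hJ)
  finally have "h (Suc n) r = - of_real J" .
  moreover have "0 \<le> J"
    unfolding J_def using IH by (intro integral_nonneg integrable_continuous_real cont_c) (auto simp: g_def exp_monomial_nonneg)
  ultimately show ?case
    using nn unfolding F_def h_def by (intro exI[of _ J]) simp
qed

lemma line_integral_resolvents:
  assumes g: "encircles_nonneg_axis \<gamma>"
    and q: "\<And>j. j \<le> n \<Longrightarrow> 0 \<le> q j" and \<alpha>: "\<And>j. j \<le> n \<Longrightarrow> 0 < \<alpha> j"
  obtains c where "0 \<le> c"
    "(\<integral>\<^sup>+u. ennreal (exp_monomial (\<alpha> 0) (q 0) (1 - (\<Sum>j=1..n. u j)) *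
        (\<Prod>j=1..n. exp_monomial (\<alpha> j) (q j) (u j))) \<partial>(Pi\<^sub>M {1..n} (\<lambda>_. lborel))) = ennreal c"
    "((\<lambda>u. exp (- \<gamma> u) * resolvents n \<alpha> q (\<gamma> u) * vector_derivative \<gamma> (at u)) has_integral
      - (2 * of_real pi * \<i> * of_real c)) UNIV"
proof -
  define a where "a = (\<Sum>j\<le>n. q j)"
  have a: "0 \<le> q j \<and> q j \<le> a" if "j \<le> n" for j
    using q that unfolding a_def by (auto intro!: member_le_sum)
  have a0: "0 \<le> a" unfolding a_def using q by (auto intro!: sum_nonneg)
  define R where "R = a + 2"
  obtain c where c: "0 \<le> c"
    "(\<integral>\<^sup>+u. ennreal (exp_monomial (\<alpha> 0) (q 0) (1 - (\<Sum>j=1..n. u j)) *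
        (\<Prod>j=1..n. exp_monomial (\<alpha> j) (q j) (u j))) \<partial>(Pi\<^sub>M {1..n} (\<lambda>_. lborel))) = ennreal c"
    "circle_mean R (\<lambda>z. exp (- (of_real 1 * z)) * resolvents n \<alpha> q z) = - of_real c"
    using simplex_convolution_resolvents[of n q a R \<alpha> 1] a a0 \<alpha> by (auto simp: R_def)
  have "((\<lambda>u. exp (- \<gamma> u) * resolvents n \<alpha> q (\<gamma> u) * vector_derivative \<gamma> (at u)) has_integral
      contour_integral (circlepath 0 R) (\<lambda>z. exp (- z) * resolvents n \<alpha> q z)) UNIV"
  \<comment> \<open>Starting the half-plane at a + 1 instead of \<open>a\<close> keeps every pole at
    distance at least 1, so the resolvents are bounded by 1 and exp(-Re z) alone bounds the
    integrand. The radius a + 2 lies beyond.\<close>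
  proof (rule has_integral_encircling[OF g, where a = "a + 1"])
    show "(\<lambda>z. exp (- z) * resolvents n \<alpha> q z) holomorphic_on - \<real>\<^sub>\<ge>\<^sub>0"
      using q by (intro holomorphic_intros holomorphic_on_resolvents) (auto simp: complex_nonneg_Reals_iff)
    show "(\<lambda>z. exp (- z) * resolvents n \<alpha> q z) holomorphic_on {z. a + 1 < Re z}"
      using a by (intro holomorphic_intros holomorphic_on_resolvents) (force simp: not_less)
    fix z :: complex assume z: "a + 1 < Re z"
    have "norm (inverse (of_real (q j) - z)) \<le> 1" if "j \<le> n" for j
    proof -
      have "1 \<le> norm (of_real (q j) - z)"
        using a[OF that] z abs_Re_le_cmod[of "of_real (q j) - z"] by simp
      then show ?thesis by (simp add: norm_inverse inverse_le_1_iff)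
    qed
    then have "norm (resolvents n \<alpha> q z) \<le> 1"
      unfolding resolvents_def prod_norm[symmetric] norm_power
      by (intro prod_le_1) (auto intro!: power_le_one)
    then show "norm (exp (- z) * resolvents n \<alpha> q z) \<le> exp (- Re z)"
      by (simp add: norm_mult mult_left_le)
  qed (use a0 in \<open>auto simp: R_def\<close>)
  then show thesis
    using c that[of c] by (simp add: contour_integral_circle_mean)
qed

section \<open>Linear changes of variables in Lebesgue integrals\<close>

lemma prod_Basis_cart: "(\<Prod>b\<in>(Basis :: (real^'n) set). f b) = (\<Prod>i\<in>UNIV. f (axis i 1))"
proof -
  have *: "(Basis :: (real^'n) set) = range (\<lambda>i. axis i 1)"
    by (auto simp: Basis_vec_def)
  show ?thesis
    by (subst *, subst prod.reindex) (auto simp: inj_on_def axis_eq_axis)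
qed

lemma borel_measurable_matrix_vector_mult [measurable]:
  "(\<lambda>x. (A :: real^'n^'m) *v x) \<in> borel_measurable borel"
  by (intro borel_measurable_continuous_onI continuous_intros)

text \<open>With the coordinates other than \<open>m\<close> frozen, \<open>c * x $ n\<close> is a
  constant because n differs from m, and the shear is a translation in the remaining
  coordinate.\<close>

lemma nn_integral_lborel_shear:
  fixes m n :: "'n::finite"
  assumes "m \<noteq> n" and g[measurable]: "g \<in> borel_measurable borel"
  shows "(\<integral>\<^sup>+x. g (x + (c * x $ n) *\<^sub>R axis m 1) \<partial>lborel) = (\<integral>\<^sup>+x. g (x :: real^'n) \<partial>lborel)"
proof -
  interpret product_sigma_finite "\<lambda>_::real^'n. lborel :: real measure" ..
  define e :: "'n \<Rightarrow> real^'n" where "e i = axis i 1" for i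
  define B where "B = (Basis :: (real^'n) set) - {e m}"
  have B: "Basis = insert (e m) B" "e m \<notin> B" "finite B" "e n \<in> B"
    using \<open>m \<noteq> n\<close> by (auto simp: B_def e_def axis_eq_axis)
  define V where "V x y = (\<Sum>b\<in>B. x b *\<^sub>R b) + y *\<^sub>R e m" for x :: "real^'n \<Rightarrow> real" and y
  have V: "(\<Sum>b\<in>Basis. (x(e m := y)) b *\<^sub>R b) = V x y" for x y
    using B(2,3) unfolding B(1) V_def
    by (subst sum.insert) (auto intro!: sum.cong simp: add.commute)
  have Vn: "V x y $ n = x (e n)" for x y
  proof -
    have "V x y $ n = (\<Sum>b\<in>B. x b * b $ n)"
      using \<open>m \<noteq> n\<close> by (simp add: V_def e_def axis_def)
    also have "\<dots> = (\<Sum>b\<in>B. if b = e n then x b else 0)"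
    proof (rule sum.cong)
      fix b assume "b \<in> B"
      then obtain i where b: "b = e i" by (auto simp: B_def Basis_vec_def e_def)
      have "b $ n = (if i = n then 1 else 0)" "b = e n \<longleftrightarrow> i = n"
        by (simp_all add: b e_def axis_eq_axis) (simp add: axis_def)
      then show "x b * b $ n = (if b = e n then x b else 0)" by simp
    qed simp
    also have "\<dots> = x (e n)" using B(3,4) by simp
    finally show ?thesis .
  qed
  have *: "(\<integral>\<^sup>+x. h x \<partial>lborel) = (\<integral>\<^sup>+x. \<integral>\<^sup>+y. h (V x y) \<partial>lborel \<partial>Pi\<^sub>M B (\<lambda>_. lborel))"
    if [measurable]: "h \<in> borel_measurable borel" for h :: "real^'n \<Rightarrow> ennreal"
  proof -
    have "(\<integral>\<^sup>+x. h x \<partial>lborel) = (\<integral>\<^sup>+x. h (\<Sum>b\<in>Basis. x b *\<^sub>R b) \<partial>Pi\<^sub>M Basis (\<lambda>_. lborel))"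
      by (subst lborel_eq) (simp add: nn_integral_distr)
    also have "\<dots> = (\<integral>\<^sup>+x. h (\<Sum>b\<in>Basis. x b *\<^sub>R b) \<partial>Pi\<^sub>M (insert (e m) B) (\<lambda>_. lborel))"
      by (simp only: B(1)[symmetric])
    also have "\<dots> = (\<integral>\<^sup>+x. \<integral>\<^sup>+y. h (V x y) \<partial>lborel \<partial>Pi\<^sub>M B (\<lambda>_. lborel))"
      by (subst product_nn_integral_insert[OF B(3,2)]) (simp_all add: B(1)[symmetric] V[unfolded fun_upd_apply])
    finally show ?thesis .
  qed
  have "(\<integral>\<^sup>+x. g (x + (c * x $ n) *\<^sub>R e m) \<partial>lborel)
      = (\<integral>\<^sup>+x. \<integral>\<^sup>+y. g (V x (c * x (e n) + 1 * y)) \<partial>lborel \<partial>Pi\<^sub>M B (\<lambda>_. lborel))"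
    by (subst *, measurable) (simp add: Vn, simp add: V_def algebra_simps)
  also have "\<dots> = (\<integral>\<^sup>+x. \<integral>\<^sup>+y. g (V x y) \<partial>lborel \<partial>Pi\<^sub>M B (\<lambda>_. lborel))"
  proof (rule nn_integral_cong)
    fix x
    show "(\<integral>\<^sup>+y. g (V x (c * x (e n) + 1 * y)) \<partial>lborel) = (\<integral>\<^sup>+y. g (V x y) \<partial>lborel)"
      by (subst (2) nn_integral_real_affine[where c = 1 and t = "c * x (e n)"]) (auto simp: V_def)
  qed
  also have "\<dots> = (\<integral>\<^sup>+x. g x \<partial>lborel)"
    by (rule *[symmetric]) (rule g)
  finally show ?thesis by (simp add: e_def)
qed

text \<open>Lebesgue measure is determined by its values on boxes, and permuting coordinates
  permutes the side lengths without changing their product.\<close>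

lemma nn_integral_lborel_permute_coords:
  fixes p :: "'n::finite \<Rightarrow> 'n"
  assumes "bij p" and g[measurable]: "g \<in> borel_measurable borel"
  shows "(\<integral>\<^sup>+x. g (\<chi> i. x $ p i) \<partial>lborel) = (\<integral>\<^sup>+x. g (x :: real^'n) \<partial>lborel)"
proof -
  let ?T = "\<lambda>x :: real^'n. \<chi> i. x $ p i"
  have [measurable]: "?T \<in> borel_measurable borel"
    by (intro borel_measurable_continuous_onI continuous_intros)
  have p: "p (inv p i) = i" "inv p (p i) = i" for i
    using \<open>bij p\<close> by (auto simp: bij_is_surj surj_f_inv_f bij_is_inj)
  have "lborel = distr lborel borel ?T"
  proof (rule lborel_eqI)
    fix l u :: "real^'n" assume le: "\<And>b. b \<in> Basis \<Longrightarrow> l \<bullet> b \<le> u \<bullet> b"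
    then have le': "l $ i \<le> u $ i" for i
      using le[of "axis i 1"] by (auto simp: Basis_vec_def inner_axis)
    have "?T -` box l u = box (\<chi> i. l $ inv p i) (\<chi> i. u $ inv p i)"
      by (auto simp: mem_box_cart) (metis p)+
    then have "emeasure (distr lborel borel ?T) (box l u) = ennreal (\<Prod>i\<in>UNIV. (u - l) $ inv p i)"
      using le' by (auto simp: emeasure_distr emeasure_lborel_box_eq prod_Basis_cart)
         (auto simp: Basis_vec_def inner_axis)
    also have "(\<Prod>i\<in>UNIV. (u - l) $ inv p i) = (\<Prod>i\<in>UNIV. (u - l) $ i)"
      using \<open>bij p\<close> by (intro prod.reindex_bij_betw[of "inv p"]) (simp add: bij_imp_bij_inv)
    finally show "emeasure (distr lborel borel ?T) (box l u) = ennreal (\<Prod>b\<in>Basis. (u - l) \<bullet> b)"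
      by (simp add: prod_Basis_cart inner_axis)
  qed simp
  then have "(\<integral>\<^sup>+x. g x \<partial>lborel) = (\<integral>\<^sup>+x. g x \<partial>distr lborel borel ?T)" by simp
  then show ?thesis by (simp add: nn_integral_distr)
qed

text \<open>Elementary matrices generate all matrices, and the formula survives products because
  determinants multiply. The product step applies the hypothesis to \<open>g\<close> composed with a
  matrix, so \<open>g\<close> is quantified inside the induction; det \<noteq> 0 is kept inside as
  well and disposes of matrices with a zero row.\<close>

lemma nn_integral_lborel_linear:
  fixes A :: "real^'n^'n"
  assumes "det A \<noteq> 0" and "g \<in> borel_measurable borel"
  shows "(\<integral>\<^sup>+x. g x \<partial>lborel) = ennreal \<bar>det A\<bar> * (\<integral>\<^sup>+x. g (A *v x) \<partial>lborel)"
proof -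
  have "\<forall>g\<in>borel_measurable borel. det A \<noteq> 0 \<longrightarrow> (\<integral>\<^sup>+x. g x \<partial>lborel) = ennreal \<bar>det A\<bar> * (\<integral>\<^sup>+x. g (A *v x) \<partial>lborel)"
  proof (induction A rule: induct_matrix_elementary[case_names mult zero_row diagonal swap1 idplus])
    case (mult A B)
    show ?case
    proof (intro ballI impI)
      fix g :: "real^'n \<Rightarrow> ennreal" assume [measurable]: "g \<in> borel_measurable borel" and "det (A ** B) \<noteq> 0"
      then have d: "det A \<noteq> 0" "det B \<noteq> 0" by (auto simp: det_mul)
      have "(\<lambda>x. g (A *v x)) \<in> borel_measurable borel" by measurable
      then have "(\<integral>\<^sup>+x. g (A *v x) \<partial>lborel) = ennreal \<bar>det B\<bar> * (\<integral>\<^sup>+x. g (A *v (B *v x)) \<partial>lborel)"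
        using mult(2) d by blast
      moreover have "(\<integral>\<^sup>+x. g x \<partial>lborel) = ennreal \<bar>det A\<bar> * (\<integral>\<^sup>+x. g (A *v x) \<partial>lborel)"
        using mult(1) d \<open>g \<in> borel_measurable borel\<close> by blast
      ultimately show "(\<integral>\<^sup>+x. g x \<partial>lborel) = ennreal \<bar>det (A ** B)\<bar> * (\<integral>\<^sup>+x. g ((A ** B) *v x) \<partial>lborel)"
        by (simp only: det_mul abs_mult ennreal_mult abs_ge_zero matrix_vector_mul_assoc mult.assoc)
    qed
  next
    case (zero_row A i)
    then show ?case by (simp add: det_zero_row)
  next
    case (diagonal A)
    show ?case
    proof (intro ballI impI)
      fix g :: "real^'n \<Rightarrow> ennreal" assume [measurable]: "g \<in> borel_measurable borel" and d: "det A \<noteq> 0"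
      have det: "det A = (\<Prod>i\<in>UNIV. A $ i $ i)" using diagonal by (rule det_diagonal)
      \<comment> \<open>The scaling factors, indexed by basis vectors as the affine substitution
        rule expects.\<close>
      define c where "c b = b \<bullet> (A *v b)" for b
      have c_axis: "c (axis i 1) = A $ i $ i" for i
        by (simp add: c_def inner_axis' matrix_vector_mult_basis column_def)
      have nz: "c b \<noteq> 0" if "b \<in> Basis" for b
        using that d by (auto simp: Basis_vec_def c_axis det)
      have eq: "0 + (\<Sum>j\<in>Basis. (c j * (x \<bullet> j)) *\<^sub>R j) = A *v x" for x
      proof -
        have "A *v x = A *v (\<Sum>j\<in>Basis. (x \<bullet> j) *\<^sub>R j)" by (simp add: euclidean_representation)
        also have "\<dots> = (\<Sum>j\<in>Basis. (x \<bullet> j) *\<^sub>R (A *v j))"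
          by (simp add: linear_sum[OF matrix_vector_mul_linear] matrix_vector_mult_scaleR)
        also have "\<dots> = (\<Sum>j\<in>Basis. (c j * (x \<bullet> j)) *\<^sub>R j)"
        proof (rule sum.cong)
          fix b :: "real^'n" assume "b \<in> Basis"
          then obtain i where b: "b = axis i 1" by (auto simp: Basis_vec_def)
          have "A *v b = c b *\<^sub>R b"
            unfolding b c_axis
            by (auto simp: matrix_vector_mult_basis column_def vec_eq_iff) (auto simp: axis_def diagonal)
          then show "(x \<bullet> b) *\<^sub>R (A *v b) = (c b * (x \<bullet> b)) *\<^sub>R b" by (simp add: mult.commute)
        qed simp
        finally show ?thesis by simp
      qed
      have "lborel = density (distr lborel borel (\<lambda>x. A *v x)) (\<lambda>_. ennreal (\<Prod>j\<in>Basis. \<bar>c j\<bar>))"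
        using lborel_affine_euclidean[of c 0] nz unfolding eq by simp
      also have "(\<Prod>j\<in>Basis. \<bar>c j\<bar>) = \<bar>det A\<bar>"
        by (simp add: det abs_prod prod_Basis_cart c_axis)
      finally have "(\<integral>\<^sup>+x. g x \<partial>lborel) = (\<integral>\<^sup>+x. g x \<partial>density (distr lborel borel (\<lambda>x. A *v x)) (\<lambda>_. ennreal \<bar>det A\<bar>))"
        by simp
      then show "(\<integral>\<^sup>+x. g x \<partial>lborel) = ennreal \<bar>det A\<bar> * (\<integral>\<^sup>+x. g (A *v x) \<partial>lborel)"
        by (simp add: nn_integral_density nn_integral_distr nn_integral_cmult)
    qed
  next
    case (swap1 m n)
    let ?p = "Transposition.transpose m n" and ?A = "\<chi> i j. mat 1 $ i $ Transposition.transpose m n j :: real^'n^'n"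
    have eq: "?A *v x = (\<chi> i. x $ ?p i)" for x
    proof -
      have "(\<Sum>j\<in>UNIV. (if i = ?p j then 1 else 0) * x $ j) = x $ ?p i" for i
      proof -
        have "(i = ?p j) = (j = ?p i)" for j by (metis transpose_involutory)
        then show ?thesis by (simp add: if_distrib[of "\<lambda>a. a * _"] cong: if_cong)
      qed
      then show ?thesis
        by (simp add: matrix_vector_mult_def mat_def vec_eq_iff)
    qed
    have d: "\<bar>det ?A\<bar> = 1"
    proof -
      have "det ?A = of_int (sign ?p) * det (mat 1 :: real^'n^'n)"
        by (rule det_permute_columns) (simp add: permutes_swap_id)
      then show ?thesis by (simp add: sign_def)
    qed
    show ?case
    proof (intro ballI impI)
      fix g :: "real^'n \<Rightarrow> ennreal" assume "g \<in> borel_measurable borel"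
      then have "(\<integral>\<^sup>+x. g (?A *v x) \<partial>lborel) = (\<integral>\<^sup>+x. g x \<partial>lborel)"
        unfolding eq by (intro nn_integral_lborel_permute_coords) simp_all
      then show "(\<integral>\<^sup>+x. g x \<partial>lborel) = ennreal \<bar>det ?A\<bar> * (\<integral>\<^sup>+x. g (?A *v x) \<partial>lborel)"
        unfolding d by simp
    qed
  next
    case (idplus m n c)
    let ?A = "\<chi> i j. if i = m \<and> j = n then c else of_bool (i = j) :: real^'n^'n"
    have "?A = (\<chi> k. if k = m then row m (mat 1) + c *s row n (mat 1) else row k (mat 1))"
      using idplus by (auto simp: vec_eq_iff row_def mat_def)
    then have d: "det ?A = 1" using det_row_operation[OF idplus, of "mat 1" c] by simp
    have eq: "?A *v x = x + (c * x $ n) *\<^sub>R axis m 1" for x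
    proof -
      have "(\<Sum>j\<in>UNIV. (if i = m \<and> j = n then c else of_bool (i = j)) * x $ j) = x $ i + c * x $ n * axis m 1 $ i" for i
      proof -
        have "(if i = m \<and> j = n then c else of_bool (i = j)) * x $ j
            = (if j = i then x $ j else 0) + (if j = n then c * x $ n * axis m 1 $ i else 0)" for j
          using idplus by (auto simp: axis_def)
        then show ?thesis by (simp add: sum.distrib)
      qed
      then show ?thesis by (simp add: matrix_vector_mult_def vec_eq_iff)
    qed
    show ?case
    proof (intro ballI impI)
      fix g :: "real^'n \<Rightarrow> ennreal" assume "g \<in> borel_measurable borel"
      then have "(\<integral>\<^sup>+x. g (?A *v x) \<partial>lborel) = (\<integral>\<^sup>+x. g x \<partial>lborel)"
        unfolding eq by (rule nn_integral_lborel_shear[OF idplus])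
      then show "(\<integral>\<^sup>+x. g x \<partial>lborel) = ennreal \<bar>det ?A\<bar> * (\<integral>\<^sup>+x. g (?A *v x) \<partial>lborel)"
        unfolding d by simp
    qed
  qed
  then show ?thesis using assms by blast
qed

text \<open>Applied to indicators, the nonnegative case exhibits \<open>lborel\<close> as a density
  over its image under \<open>A\<close>. Signed functions then transform by the rules for densities
  and images, with no splitting into positive and negative parts.\<close>

lemma has_bochner_integral_lborel_linear:
  fixes A :: "real^'n^'n" and f :: "real^'n \<Rightarrow> real"
  assumes d: "det A \<noteq> 0" and f: "f \<in> borel_measurable borel"
    and I: "has_bochner_integral lborel (\<lambda>x. f (A *v x)) I"
  shows "has_bochner_integral lborel f (\<bar>det A\<bar> * I)"
proof -
  note [measurable] = f
  have [measurable]: "(\<lambda>x. A *v x) \<in> lborel \<rightarrow>\<^sub>M borel" by simp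
  have "lborel = density (distr lborel borel (\<lambda>x. A *v x)) (\<lambda>_. ennreal \<bar>det A\<bar>)" (is "_ = ?D")
  proof (rule measure_eqI)
    fix X assume X[measurable]: "X \<in> sets (lborel :: (real^'n) measure)"
    have "emeasure lborel X = (\<integral>\<^sup>+x. indicator X x \<partial>lborel)"
      by (simp only: nn_integral_indicator[OF X])
    also have "\<dots> = ennreal \<bar>det A\<bar> * (\<integral>\<^sup>+x. indicator X (A *v x) \<partial>lborel)"
      using d by (rule nn_integral_lborel_linear) simp
    also have "\<dots> = ennreal \<bar>det A\<bar> * (\<integral>\<^sup>+x. indicator X x \<partial>distr lborel borel (\<lambda>x. A *v x))"
      by (subst nn_integral_distr) (use X in auto)
    also have "\<dots> = (\<integral>\<^sup>+x. ennreal \<bar>det A\<bar> * indicator X x \<partial>distr lborel borel (\<lambda>x. A *v x))"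
      by (subst nn_integral_cmult) (use X in auto)
    also have "\<dots> = emeasure ?D X"
      by (subst emeasure_density) (use X in auto)
    finally show "emeasure lborel X = emeasure ?D X" .
  qed simp
  moreover have "has_bochner_integral ?D f (\<bar>det A\<bar> * I)"
    by (intro has_bochner_integral_density has_bochner_integral_distr) 
       (auto intro!: has_bochner_integral_mult_right I)
  ultimately show ?thesis by simp
qed

section \<open>Positive definite matrices\<close>

lemma matrix_inv_eqI:
  fixes A :: "real^'n^'n"
  assumes "A ** B = mat 1"
  shows "matrix_inv A = B"
proof -
  have "B ** A = mat 1" using assms by (simp add: matrix_left_right_inverse)
  then have "matrix_inv A ** A = mat 1"
    unfolding matrix_inv_def using assms by (rule_tac someI2[of _ B]) auto
  then show ?thesis
    by (metis assms matrix_mul_assoc matrix_mul_lid matrix_mul_rid)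
qed

lemma inner_matrix_symmetric:
  fixes P :: "real^'n^'n"
  assumes "transpose P = P"
  shows "x \<bullet> (P *v y) = y \<bullet> (P *v x)"
  by (metis assms dot_lmul_matrix inner_commute transpose_matrix_vector)

text \<open>Gram--Schmidt for the inner product defined by the matrix.\<close>

lemma positive_definite_orthonormal:
  fixes P :: "real^'n^'n"
  assumes "positive_definite P"
  obtains A :: "real^'n^'n" where "transpose A ** P ** A = mat 1"
proof -
  have sym: "transpose P = P" and pos: "\<And>x. x \<noteq> 0 \<Longrightarrow> 0 < x \<bullet> (P *v x)"
    using assms by (auto simp: positive_definite_def)
  have "\<exists>b. \<forall>i\<in>J. \<forall>j\<in>J. b i \<bullet> (P *v b j) = (if i = j then 1 else 0)" for J :: "'n set"
    using finite[of J]
  proof (induction J rule: finite_induct)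
    case (insert k J)
    then obtain b where b: "\<And>i j. i \<in> J \<Longrightarrow> j \<in> J \<Longrightarrow> b i \<bullet> (P *v b j) = (if i = j then 1 else 0)"
      by blast
    \<comment> \<open>Fewer vectors P b_i than the dimension cannot span the space, so some nonzero
      \<open>x\<close> is orthogonal to all of them. That is orthogonality to the b_i for the form
      of \<open>P\<close>, and no projections have to be subtracted.\<close>
    let ?S = "(\<lambda>i. P *v b i) ` J"
    have "dim ?S \<le> card ?S" by (rule dim_le_card[OF span_superset]) (auto intro: insert)
    also have "\<dots> \<le> card J" by (rule card_image_le) (rule insert)
    also have "\<dots> < CARD('n)" using insert by (metis UNIV_I card_seteq finite not_less subset_UNIV)
    finally have "dim ?S < DIM(real^'n)" by simp
    then obtain x where x: "x \<noteq> 0" "\<And>y. y \<in> span ?S \<Longrightarrow> orthogonal x y"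
      by (rule orthogonal_to_subspace_exists) blast
    have 0: "x \<bullet> (P *v b i) = 0" "b i \<bullet> (P *v x) = 0" if "i \<in> J" for i
      using x(2)[OF span_base, of "P *v b i"] that inner_matrix_symmetric[OF sym, of x "b i"]
      by (auto simp: orthogonal_def)
    let ?b = "b(k := inverse (sqrt (x \<bullet> (P *v x))) *\<^sub>R x)"
    have "\<forall>i\<in>insert k J. \<forall>j\<in>insert k J. ?b i \<bullet> (P *v ?b j) = (if i = j then 1 else 0)"
      using b 0 pos[OF x(1)] insert(2)
      by (auto simp: matrix_vector_mult_scaleR field_simps)
    then show ?case by blast
  qed simp
  from this[of UNIV] obtain b :: "'n \<Rightarrow> real^'n"
    where "\<forall>i\<in>UNIV. \<forall>j\<in>UNIV. b i \<bullet> (P *v b j) = (if i = j then 1 else 0)" ..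
  then have b: "b i \<bullet> (P *v b j) = (if i = j then 1 else 0)" for i j
    by blast
  define A where "A = (\<chi> i j. b j $ i)"
  have "transpose A ** P ** A = mat 1"
  proof -
    have "(transpose A ** P ** A) $ i $ j = b i \<bullet> (P *v b j)" for i j
    proof -
      have "(transpose A ** (P ** A)) $ i $ j = b i \<bullet> (P *v b j)"
        by (simp add: matrix_matrix_mult_def matrix_vector_mult_def transpose_def A_def inner_vec_def)
      then show ?thesis by (simp add: matrix_mul_assoc)
    qed
    then show ?thesis by (simp add: vec_eq_iff mat_def b)
  qed
  then show thesis by (rule that)
qed

section \<open>Gaussian moments\<close>

text \<open>The recursion is integration by parts, but it is read off the closed formulas for the
  even and odd moments, which avoids boundary terms at infinity.\<close>

lemma gaussian_monomial:
  "integrable lborel (\<lambda>y::real. y ^ k * exp (- y\<^sup>2))" (is ?I)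
  "(\<integral>y. y ^ Suc k * exp (- y\<^sup>2) \<partial>lborel) = real k / 2 * (\<integral>y. y ^ (k - 1) * exp (- y\<^sup>2) \<partial>lborel)" (is ?R)
proof -
  have even: "has_bochner_integral lborel (\<lambda>y::real. y ^ (2 * j) * exp (- y\<^sup>2))
      (2 * ((sqrt pi / 2) * (fact (2 * j) / (2 ^ (2 * j) * fact j))))" for j
    using has_bochner_integral_even_function[OF gaussian_moment_even_pos[of j]] by (simp add: mult.commute)
  have odd: "has_bochner_integral lborel (\<lambda>y::real. y ^ (2 * j + 1) * exp (- y\<^sup>2)) 0" for j
    using has_bochner_integral_odd_function[OF gaussian_moment_odd_pos[of j]] by (simp add: mult.commute)
  show ?I
    using even[of "k div 2"] odd[of "k div 2"] by (cases "even k") (auto simp: has_bochner_integral_iff)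
  show ?R
  proof (cases "even k")
    case True
    then obtain j where j: "k = 2 * j" by (elim evenE)
    have 0: "(\<integral>(y::real). y ^ Suc k * exp (- y\<^sup>2) \<partial>lborel) = 0"
      using has_bochner_integral_integral_eq[OF odd[of j]] j by simp
    show ?thesis
    \<comment> \<open>For k = 0 the exponent \<open>k - 1\<close> truncates to 0, and the factor
      \<open>k\<close> makes the right side 0 all the same.\<close>
    proof (cases "k = 0")
      case False
      then have "k - 1 = 2 * (j - 1) + 1" using j by auto
      then have "(\<integral>(y::real). y ^ (k - 1) * exp (- y\<^sup>2) \<partial>lborel) = 0"
        using has_bochner_integral_integral_eq[OF odd[of "j - 1"]] by (simp only:)
      then show ?thesis unfolding 0 by simp
    qed (use 0 in simp)
  next
    case False
    then obtain j where j: "k = 2 * j + 1" by (elim oddE)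
    have "2 * ((sqrt pi / 2) * (fact (2 * Suc j) / (2 ^ (2 * Suc j) * fact (Suc j))))
        = real k / 2 * (2 * ((sqrt pi / 2) * (fact (2 * j) / (2 ^ (2 * j) * fact j))))"
      by (simp add: j divide_simps)
    moreover have "Suc k = 2 * Suc j" "k - 1 = 2 * j" using j by auto
    ultimately show ?thesis
      by (simp only: even[THEN has_bochner_integral_integral_eq])
  qed
qed

text \<open>On a line in a coordinate direction a product of linear forms is a polynomial in the
  coordinate, which is where this is applied. Both sides of the identity are linear in
  \<open>p\<close>, so monomials suffice.\<close>

lemma gaussian_poly:
  fixes p :: "real poly"
  shows "integrable lborel (\<lambda>y. poly p y * exp (- y\<^sup>2))"
    and "(\<integral>y. y * poly p y * exp (- y\<^sup>2) \<partial>lborel) = (\<integral>y. poly (pderiv p) y * exp (- y\<^sup>2) \<partial>lborel) / 2"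
proof -
  have p: "poly p y * c = (\<Sum>i\<le>degree p. coeff p i * (y ^ i * c))" for y c
    by (simp add: poly_altdef sum_distrib_right mult.assoc)
  show int: "integrable lborel (\<lambda>y. poly p y * exp (- y\<^sup>2))" for p :: "real poly"
    unfolding poly_altdef sum_distrib_right mult.assoc
    by (intro Bochner_Integration.integrable_sum integrable_mult_right gaussian_monomial)
  have "(\<integral>y. y * poly p y * exp (- y\<^sup>2) \<partial>lborel) = (\<integral>y. (\<Sum>i\<le>degree p. coeff p i * (y ^ Suc i * exp (- y\<^sup>2))) \<partial>lborel)"
    by (simp add: poly_altdef sum_distrib_left sum_distrib_right mult_ac)
  also have "\<dots> = (\<Sum>i\<le>degree p. coeff p i * (\<integral>y. y ^ Suc i * exp (- y\<^sup>2) \<partial>lborel))"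
    by (subst Bochner_Integration.integral_sum) (intro integrable_mult_right gaussian_monomial, simp)
  also have "\<dots> = (\<Sum>i\<le>degree p. (\<integral>y. poly (pderiv (monom (coeff p i) i)) y * exp (- y\<^sup>2) \<partial>lborel) / 2)"
    by (intro sum.cong refl) (simp only: gaussian_monomial(2), simp add: pderiv_monom poly_monom mult.assoc)
  also have "\<dots> = (\<integral>y. (\<Sum>i\<le>degree p. poly (pderiv (monom (coeff p i) i)) y * exp (- y\<^sup>2)) \<partial>lborel) / 2"
    by (subst Bochner_Integration.integral_sum) (auto intro: int simp: sum_divide_distrib)
  also have "(\<lambda>y. \<Sum>i\<le>degree p. poly (pderiv (monom (coeff p i) i)) y * exp (- y\<^sup>2)) = (\<lambda>y. poly (pderiv p) y * exp (- y\<^sup>2))"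
  proof
    fix y
    have "pderiv (sum f A) = (\<Sum>i\<in>A. pderiv (f i))" for f :: "nat \<Rightarrow> real poly" and A
      by (induction A rule: infinite_finite_induct) (simp_all add: pderiv_add)
    then have "pderiv p = (\<Sum>i\<le>degree p. pderiv (monom (coeff p i) i))"
      by (metis poly_as_sum_of_monoms)
    then show "(\<Sum>i\<le>degree p. poly (pderiv (monom (coeff p i) i)) y * exp (- y\<^sup>2)) = poly (pderiv p) y * exp (- y\<^sup>2)"
      by (simp add: poly_sum sum_distrib_right)
  qed
  finally show "(\<integral>y. y * poly p y * exp (- y\<^sup>2) \<partial>lborel) = (\<integral>y. poly (pderiv p) y * exp (- y\<^sup>2) \<partial>lborel) / 2" .
qed

lemma integrable_gaussian_1:
  assumes "0 < c"
  shows "integrable lborel (\<lambda>y::real. exp (- c * y\<^sup>2))"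
  using lborel_integrable_real_affine[OF gaussian_monomial(1)[of 0], of "sqrt c" 0] assms
  by (simp add: power_mult_distrib)

lemma exp_inner_Basis:
  "exp (- c * (x \<bullet> x)) = (\<Prod>b\<in>Basis. exp (- c * (x \<bullet> b)\<^sup>2))" for x :: "'a::euclidean_space"
  by (subst euclidean_inner) (simp add: exp_sum sum_distrib_left power2_eq_square mult.assoc flip: sum_negf)

lemma
  fixes f :: "'a::euclidean_space \<Rightarrow> real \<Rightarrow> real"
  assumes f: "\<And>b. b \<in> Basis \<Longrightarrow> integrable lborel (f b)"
  shows integrable_lborel_prod: "integrable lborel (\<lambda>x::'a. \<Prod>b\<in>Basis. f b (x \<bullet> b))"
    and integral_lborel_prod: "(\<integral>(x::'a). (\<Prod>b\<in>Basis. f b (x \<bullet> b)) \<partial>lborel) = (\<Prod>b\<in>Basis. \<integral>y. f b y \<partial>lborel)"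
proof -
  interpret product_sigma_finite "\<lambda>_::'a. lborel :: real measure" ..
  have [measurable]: "f b \<in> borel_measurable borel" if "b \<in> Basis" for b
    using borel_measurable_integrable[OF f[OF that]] by simp
  have *: "(\<Prod>b\<in>Basis. f b ((\<Sum>b\<in>Basis. x b *\<^sub>R b) \<bullet> b)) = (\<Prod>b\<in>Basis. f b (x b))" for x :: "'a \<Rightarrow> real"
    by (intro prod.cong) auto
  show "integrable lborel (\<lambda>x::'a. \<Prod>b\<in>Basis. f b (x \<bullet> b))"
    by (subst lborel_eq) (subst integrable_distr_eq, auto simp: * intro!: product_integrable_prod f)
  show "(\<integral>(x::'a). (\<Prod>b\<in>Basis. f b (x \<bullet> b)) \<partial>lborel) = (\<Prod>b\<in>Basis. \<integral>y. f b y \<partial>lborel)"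
    by (subst lborel_eq) (subst integral_distr, auto simp: * intro!: product_integral_prod f)
qed

lemma integrable_gaussian:
  assumes "0 < c"
  shows "integrable lborel (\<lambda>x::'a::euclidean_space. exp (- c * (x \<bullet> x)))"
  unfolding exp_inner_Basis by (intro integrable_lborel_prod integrable_gaussian_1 assms)

lemma integral_gaussian:
  "(\<integral>(x::'a::euclidean_space). exp (- (x \<bullet> x)) \<partial>lborel) = sqrt pi ^ DIM('a)"
proof -
  have "(\<integral>(y::real). exp (- y\<^sup>2) \<partial>lborel) = sqrt pi"
    using has_bochner_integral_even_function[OF gaussian_moment_0] by (simp add: has_bochner_integral_iff)
  moreover have "(\<integral>(x::'a). exp (- 1 * (x \<bullet> x)) \<partial>lborel) = (\<Prod>b\<in>(Basis :: 'a set). \<integral>y. exp (- 1 * y\<^sup>2) \<partial>lborel)"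
    unfolding exp_inner_Basis by (intro integral_lborel_prod integrable_gaussian_1) simp
  ultimately show ?thesis by simp
qed

lemma integrable_norm_power_gaussian:
  assumes c: "0 < c"
  shows "integrable lborel (\<lambda>x::'a::euclidean_space. norm x ^ m * exp (- c * (x \<bullet> x)))"
proof (cases "m = 0")
  case True
  then show ?thesis using integrable_gaussian[OF c] by simp
next
  case False
  \<comment> \<open>Half of the exponent absorbs the growth. The 1 covers norms up to 1; beyond, the
    m-th power of the norm is at most (x \<bullet> x)^m, which is (2m/c)^m (y/m)^m for y = (c/2)(x
    \<bullet> x), and (y/m)^m is at most exp y. The division by \<open>m\<close> is why m = 0 is
    treated apart.\<close>
  define K where "K = 1 + (2 * real m / c) ^ m"
  have "integrable lborel (\<lambda>x::'a. K * exp (- (c / 2) * (x \<bullet> x)))"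
    by (intro integrable_mult_right integrable_gaussian) (use c in simp)
  then show ?thesis
  proof (rule Bochner_Integration.integrable_bound)
    show "AE x::'a in lborel. norm (norm x ^ m * exp (- c * (x \<bullet> x))) \<le> norm (K * exp (- (c / 2) * (x \<bullet> x)))"
    proof (rule AE_I2)
      fix x :: 'a
      define y where "y = (c / 2) * (x \<bullet> x)"
      have y: "0 \<le> y" using c by (simp add: y_def)
      have "norm x ^ m \<le> 1 + (x \<bullet> x) ^ m"
      proof (cases "norm x \<le> 1")
        case True
        then show ?thesis by (simp add: power_le_one add_increasing2)
      next
        case False
        then have "norm x ^ m \<le> norm x ^ (2 * m)" by (intro power_increasing) auto
        then show ?thesis by (simp add: power_mult dot_square_norm)
      qed
      also have "(x \<bullet> x) ^ m \<le> (2 * real m / c) ^ m * exp y"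
      proof -
        have "x \<bullet> x = (2 * real m / c) * (y / m)"
          using c \<open>m \<noteq> 0\<close> by (simp add: y_def)
        then have "(x \<bullet> x) ^ m = (2 * real m / c) ^ m * (y / m) ^ m"
          by (simp only: power_mult_distrib)
        moreover have "(y / m) ^ m \<le> (1 + y / m) ^ m" using y by (intro power_mono) auto
        moreover have "(1 + y / m) ^ m \<le> exp y"
          using y \<open>m \<noteq> 0\<close> by (intro exp_ge_one_plus_x_over_n_power_n) auto
        ultimately show ?thesis using c by (simp add: mult_left_mono)
      qed
      also have "1 + (2 * real m / c) ^ m * exp y \<le> K * exp y"
        using y c by (simp add: K_def algebra_simps)
      finally have "norm x ^ m \<le> K * exp y" by simp
      then have "norm x ^ m * exp (- c * (x \<bullet> x)) \<le> K * exp y * exp (- c * (x \<bullet> x))"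
        by (rule mult_right_mono) simp
      also have "\<dots> = K * exp (- (c / 2) * (x \<bullet> x))"
        by (simp add: y_def mult.assoc exp_add[symmetric])
      finally show "norm (norm x ^ m * exp (- c * (x \<bullet> x))) \<le> norm (K * exp (- (c / 2) * (x \<bullet> x)))"
        by simp
    qed
  qed measurable
qed

lemma abs_prod_inner_le:
  fixes x :: "'a::real_inner"
  assumes "finite M"
  shows "\<bar>\<Prod>i\<in>M. a i \<bullet> x\<bar> \<le> (\<Prod>i\<in>M. norm (a i)) * norm x ^ card M"
proof -
  have "\<bar>\<Prod>i\<in>M. a i \<bullet> x\<bar> = (\<Prod>i\<in>M. \<bar>a i \<bullet> x\<bar>)" by (rule abs_prod)
  also have "\<dots> \<le> (\<Prod>i\<in>M. norm (a i) * norm x)"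
    by (intro prod_mono) (auto simp: Cauchy_Schwarz_ineq2)
  finally show ?thesis by (simp add: prod.distrib)
qed

lemma integrable_prod_inner_gaussian:
  fixes a :: "'i \<Rightarrow> 'a::euclidean_space"
  assumes "finite M"
  shows "integrable lborel (\<lambda>x. (\<Prod>i\<in>M. a i \<bullet> x) * exp (- (x \<bullet> x)))"
proof -
  have "integrable lborel (\<lambda>x::'a. (\<Prod>i\<in>M. norm (a i)) * (norm x ^ card M * exp (- 1 * (x \<bullet> x))))"
    by (intro integrable_mult_right integrable_norm_power_gaussian) simp
  then show ?thesis
    by (rule Bochner_Integration.integrable_bound)
      (use abs_prod_inner_le[OF assms, of a] in \<open>auto simp: abs_mult mult.assoc[symmetric] abs_of_nonneg prod_nonneg intro!: mult_right_mono\<close>)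
qed

lemma integral_lborel_Basis_direction:
  fixes h :: "'a::euclidean_space \<Rightarrow> real"
  assumes b: "b \<in> Basis" and h: "integrable lborel h"
  shows "(\<integral>x. h x \<partial>lborel) =
    (\<integral>x. \<integral>y. h ((\<Sum>c\<in>Basis - {b}. x c *\<^sub>R c) + y *\<^sub>R b) \<partial>lborel \<partial>Pi\<^sub>M (Basis - {b}) (\<lambda>_. lborel))"
proof -
  interpret product_sigma_finite "\<lambda>_::'a. lborel :: real measure" ..
  note [measurable] = borel_measurable_integrable[OF h]
  have B: "insert b (Basis - {b}) = Basis" using b by auto
  have V: "(\<Sum>c\<in>Basis. (x(b := y)) c *\<^sub>R c) = (\<Sum>c\<in>Basis - {b}. x c *\<^sub>R c) + y *\<^sub>R b" for x and y :: real
    using b by (subst sum.remove[of _ b]) (auto intro!: sum.cong simp: add.commute)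
  have i: "integrable (Pi\<^sub>M Basis (\<lambda>_. lborel)) (\<lambda>x. h (\<Sum>c\<in>Basis. x c *\<^sub>R c))"
    using h by (subst (asm) lborel_eq) (subst (asm) integrable_distr_eq, auto)
  have "(\<integral>x. h x \<partial>lborel) = (\<integral>x. h (\<Sum>c\<in>Basis. x c *\<^sub>R c) \<partial>Pi\<^sub>M Basis (\<lambda>_. lborel))"
    by (subst lborel_eq) (subst integral_distr, auto)
  also have "\<dots> = (\<integral>x. \<integral>y. h (\<Sum>c\<in>Basis. (x(b := y)) c *\<^sub>R c) \<partial>lborel \<partial>Pi\<^sub>M (Basis - {b}) (\<lambda>_. lborel))"
    using product_integral_insert[of "Basis - {b}" b "\<lambda>x. h (\<Sum>c\<in>Basis. x c *\<^sub>R c)"] i by (simp only: B) simp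
  finally show ?thesis by (simp only: V)
qed

text \<open>On a line v + y b with v orthogonal to b the weight splits into a constant and
  exp(-y^2), and the product of linear forms is a polynomial in y. By the one-dimensional identity
  and the product rule, the two sides already agree line by line, before the integration over
  \<open>v\<close>.\<close>

lemma gaussian_integration_by_parts:
  fixes a :: "'i \<Rightarrow> 'a::euclidean_space"
  assumes b: "b \<in> Basis" and M: "finite M"
  shows "(\<integral>x. (b \<bullet> x) * (\<Prod>i\<in>M. a i \<bullet> x) * exp (- (x \<bullet> x)) \<partial>lborel) =
    (\<Sum>k\<in>M. (b \<bullet> a k) / 2 * (\<integral>x. (\<Prod>i\<in>M - {k}. a i \<bullet> x) * exp (- (x \<bullet> x)) \<partial>lborel))"
proof -
  let ?G = "\<lambda>x. (b \<bullet> x) * (\<Prod>i\<in>M. a i \<bullet> x) * exp (- (x \<bullet> x))"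
  let ?H = "\<lambda>x. (\<Sum>k\<in>M. (b \<bullet> a k) / 2 * ((\<Prod>i\<in>M - {k}. a i \<bullet> x) * exp (- (x \<bullet> x))))"
  \<comment> \<open>The index type may have no spare element for the extra factor \<open>b\<close>;
    passing to options provides one.\<close>
  have "integrable lborel (\<lambda>x. (\<Prod>i\<in>insert None (Some ` M). (case i of None \<Rightarrow> b | Some i \<Rightarrow> a i) \<bullet> x) * exp (- (x \<bullet> x)))"
    using M by (intro integrable_prod_inner_gaussian) auto
  then have G: "integrable lborel ?G"
    using M by (simp add: prod.reindex)
  have H: "integrable lborel ?H"
    using M by (intro Bochner_Integration.integrable_sum integrable_mult_right integrable_prod_inner_gaussian) auto
  have "(\<integral>y. ?G (v + y *\<^sub>R b) \<partial>lborel) = (\<integral>y. ?H (v + y *\<^sub>R b) \<partial>lborel)" if v: "v \<bullet> b = 0" for v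
  proof -
    define p where "p = (\<Prod>i\<in>M. [:a i \<bullet> v, b \<bullet> a i:])"
    have w: "(v + y *\<^sub>R b) \<bullet> (v + y *\<^sub>R b) = v \<bullet> v + y\<^sup>2" for y
      using v b by (simp add: inner_simps inner_commute[of b v] power2_eq_square)
    have e: "exp (- (v \<bullet> v + y\<^sup>2)) = exp (- (v \<bullet> v)) * exp (- y\<^sup>2)" for y
      by (simp add: exp_add[symmetric])
    have u: "b \<bullet> (v + y *\<^sub>R b) = y" for y
      using v b by (simp add: inner_simps inner_commute[of b v])
    have q: "(\<Prod>i\<in>N. a i \<bullet> (v + y *\<^sub>R b)) = poly (\<Prod>i\<in>N. [:a i \<bullet> v, b \<bullet> a i:]) y" for y N
      by (simp add: poly_prod inner_simps inner_commute[of b])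
    have "?G (v + y *\<^sub>R b) = exp (- (v \<bullet> v)) * (y * poly p y * exp (- y\<^sup>2))" for y
      unfolding w e u q p_def[symmetric] by (simp only: mult_ac)
    moreover have "?H (v + y *\<^sub>R b) = exp (- (v \<bullet> v)) * (poly (pderiv p) y * exp (- y\<^sup>2) / 2)" for y
      unfolding w e q p_def pderiv_prod poly_sum poly_mult sum_distrib_left sum_distrib_right sum_divide_distrib
      by (intro sum.cong refl) (simp add: pderiv_pCons)
    ultimately show ?thesis
      by (simp only: integral_mult_right_zero integral_divide_zero gaussian_poly)
  qed
  moreover have "(\<Sum>c\<in>Basis - {b}. x c *\<^sub>R c) \<bullet> b = 0" for x
    using b by (auto simp: inner_sum_left inner_Basis intro!: sum.neutral)
  ultimately have "(\<integral>y. ?G ((\<Sum>c\<in>Basis - {b}. x c *\<^sub>R c) + y *\<^sub>R b) \<partial>lborel) =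
      (\<integral>y. ?H ((\<Sum>c\<in>Basis - {b}. x c *\<^sub>R c) + y *\<^sub>R b) \<partial>lborel)" for x
    by blast
  then have "(\<integral>x. ?G x \<partial>lborel) = (\<integral>x. ?H x \<partial>lborel)"
    by (simp only: integral_lborel_Basis_direction[OF b G] integral_lborel_Basis_direction[OF b H])
  also have "\<dots> = (\<Sum>k\<in>M. (b \<bullet> a k) / 2 * (\<integral>x. (\<Prod>i\<in>M - {k}. a i \<bullet> x) * exp (- (x \<bullet> x)) \<partial>lborel))"
    using M by (subst Bochner_Integration.integral_sum)
      (auto intro!: integrable_mult_right integrable_prod_inner_gaussian)
  finally show ?thesis .
qed

text \<open>Integration by parts is available for basis vectors only. As \<open>a m\<close> enters
  linearly, it is expanded in the orthonormal basis, and the coefficients recombine to its inner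
  product with \<open>a k\<close>.\<close>

lemma gaussian_recursion:
  fixes a :: "'i \<Rightarrow> 'a::euclidean_space"
  assumes "finite M" "m \<notin> M"
  shows "(\<integral>x. (\<Prod>i\<in>insert m M. a i \<bullet> x) * exp (- (x \<bullet> x)) \<partial>lborel) =
    (\<Sum>k\<in>M. (a m \<bullet> a k) / 2 * (\<integral>x. (\<Prod>i\<in>M - {k}. a i \<bullet> x) * exp (- (x \<bullet> x)) \<partial>lborel))"
proof -
  let ?W = "\<lambda>k. \<integral>x. (\<Prod>i\<in>M - {k}. a i \<bullet> x) * exp (- (x \<bullet> x)) \<partial>lborel"
  have int: "integrable lborel (\<lambda>x. (b \<bullet> x) * (\<Prod>i\<in>M. a i \<bullet> x) * exp (- (x \<bullet> x)))" for b
  proof -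
    have "integrable lborel (\<lambda>x. (\<Prod>i\<in>insert None (Some ` M). (case i of None \<Rightarrow> b | Some i \<Rightarrow> a i) \<bullet> x) * exp (- (x \<bullet> x)))"
      using assms by (intro integrable_prod_inner_gaussian) auto
    then show ?thesis using assms by (simp add: prod.reindex)
  qed
  have "(\<Prod>i\<in>insert m M. a i \<bullet> x) * exp (- (x \<bullet> x)) =
      (\<Sum>b\<in>Basis. (a m \<bullet> b) * ((b \<bullet> x) * (\<Prod>i\<in>M. a i \<bullet> x) * exp (- (x \<bullet> x))))" for x
  proof -
    have "a m \<bullet> x = (\<Sum>b\<in>Basis. (a m \<bullet> b) * (b \<bullet> x))"
      by (subst euclidean_inner) (simp add: inner_commute)
    moreover have "(\<Prod>i\<in>insert m M. a i \<bullet> x) = (a m \<bullet> x) * (\<Prod>i\<in>M. a i \<bullet> x)"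
      using assms by simp
    ultimately show ?thesis by (simp only: sum_distrib_right mult.assoc)
  qed
  then have "(\<integral>x. (\<Prod>i\<in>insert m M. a i \<bullet> x) * exp (- (x \<bullet> x)) \<partial>lborel) =
      (\<Sum>b\<in>Basis. (a m \<bullet> b) * (\<integral>x. (b \<bullet> x) * (\<Prod>i\<in>M. a i \<bullet> x) * exp (- (x \<bullet> x)) \<partial>lborel))"
    by (simp only: Bochner_Integration.integral_sum[OF integrable_mult_right[OF int]] integral_mult_right_zero)
  also have "\<dots> = (\<Sum>b\<in>Basis. \<Sum>k\<in>M. (a m \<bullet> b) * (a k \<bullet> b) / 2 * ?W k)"
  proof (rule sum.cong)
    fix b :: 'a assume "b \<in> Basis"
    show "(a m \<bullet> b) * (\<integral>x. (b \<bullet> x) * (\<Prod>i\<in>M. a i \<bullet> x) * exp (- (x \<bullet> x)) \<partial>lborel) = (\<Sum>k\<in>M. (a m \<bullet> b) * (a k \<bullet> b) / 2 * ?W k)"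
      unfolding gaussian_integration_by_parts[OF \<open>b \<in> Basis\<close> assms(1)] sum_distrib_left
      by (intro sum.cong refl) (simp add: inner_commute[of b])
  qed simp
  also have "\<dots> = (\<Sum>k\<in>M. (a m \<bullet> a k) / 2 * ?W k)"
    by (subst sum.swap) (simp only: sum_distrib_right[symmetric] sum_divide_distrib[symmetric] euclidean_inner[symmetric])
  finally show ?thesis .
qed

section \<open>Perfect matchings and Wick's formula\<close>

lemma pairings_iff:
  "\<sigma> \<in> pairings A \<longleftrightarrow> (\<forall>i. i \<notin> A \<longrightarrow> \<sigma> i = i) \<and> (\<forall>i\<in>A. \<sigma> i \<in> A \<and> \<sigma> i \<noteq> i \<and> \<sigma> (\<sigma> i) = i)"
  (is "_ \<longleftrightarrow> ?R")
proof
  assume "\<sigma> \<in> pairings A"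
  then show ?R by (auto simp: pairings_def permutes_in_image permutes_not_in)
next
  assume R: ?R
  then have "\<sigma> (\<sigma> i) = i" for i by metis
  then have "\<exists>!j. \<sigma> j = i" for i by metis
  then show "\<sigma> \<in> pairings A" using R by (auto simp: pairings_def permutes_def)
qed

lemma finite_pairings: "finite A \<Longrightarrow> finite (pairings A)"
  using finite_permutations[of A] by (rule_tac finite_subset) (auto simp: pairings_def)

lemma pairings_empty: "pairings {} = {id}"
  by (auto simp: pairings_def)

text \<open>A matching amounts to the partner \<open>k\<close> of the least element and a matching
  of what is left. Minimality makes \<open>m\<close> the lower end of its pair, so the pair
  contributes \<open>g m k\<close> and not \<open>g k m\<close>; symmetry of \<open>g\<close> does
  not enter.\<close>

lemma sum_pairings_insert:
  fixes g :: "nat \<Rightarrow> nat \<Rightarrow> 'b::comm_semiring_1"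
  assumes M: "finite M" and m: "\<And>k. k \<in> M \<Longrightarrow> m < k"
  shows "(\<Sum>\<sigma>\<in>pairings (insert m M). \<Prod>i\<in>{i\<in>insert m M. i < \<sigma> i}. g i (\<sigma> i)) =
    (\<Sum>k\<in>M. g m k * (\<Sum>\<tau>\<in>pairings (M - {k}). \<Prod>i\<in>{i\<in>M - {k}. i < \<tau> i}. g i (\<tau> i)))"
proof -
  have mM: "m \<notin> M" using m by auto
  \<comment> \<open>\<open>J\<close> cuts out the pair of \<open>m\<close> and turns both members
    into fixed points, since a matching of the remaining set has to be the identity off that set;
    \<open>I\<close> glues the pair back.\<close>
  define J where "J \<sigma> = (\<sigma> m, \<sigma>(m := m, \<sigma> m := \<sigma> m))" for \<sigma> :: "nat \<Rightarrow> nat"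
  define I where "I = (\<lambda>(k, \<tau>). \<tau>(m := k, k := m :: nat))"
  have "(\<Sum>\<sigma>\<in>pairings (insert m M). \<Prod>i\<in>{i\<in>insert m M. i < \<sigma> i}. g i (\<sigma> i)) =
      (\<Sum>(k, \<tau>)\<in>(SIGMA k:M. pairings (M - {k})). g m k * (\<Prod>i\<in>{i\<in>M - {k}. i < \<tau> i}. g i (\<tau> i)))"
  proof (rule sum.reindex_bij_witness[where i = I and j = J])
    fix \<sigma> assume s: "\<sigma> \<in> pairings (insert m M)"
    define k where "k = \<sigma> m"
    have s': "k \<in> M" "\<sigma> k = m" "k \<noteq> m" using s by (auto simp: pairings_iff k_def)
    have km: "\<sigma> m = k" by (simp add: k_def)
    define \<tau> where "\<tau> = \<sigma>(m := m, k := k)"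
    have J: "J \<sigma> = (k, \<tau>)" by (simp add: J_def k_def \<tau>_def)
    show "I (J \<sigma>) = \<sigma>" using s' by (auto simp: fun_eq_iff J I_def \<tau>_def k_def)
    have "\<tau> \<in> pairings (M - {k})"
      unfolding pairings_iff
    proof (intro conjI allI impI ballI)
      fix i assume "i \<notin> M - {k}"
      then show "\<tau> i = i" using s by (auto simp: \<tau>_def pairings_iff)
    next
      fix i assume i: "i \<in> M - {k}"
      then have ti: "\<tau> i = \<sigma> i" "\<sigma> i \<in> insert m M" "\<sigma> i \<noteq> i" "\<sigma> (\<sigma> i) = i"
        using s mM by (auto simp: \<tau>_def pairings_iff)
      have "\<sigma> i \<noteq> m" using ti i k_def by auto
      moreover have "\<sigma> i \<noteq> k" using ti i s' mM by auto
      ultimately show "\<tau> i \<in> M - {k}" "\<tau> i \<noteq> i" "\<tau> (\<tau> i) = i" using ti by (auto simp: \<tau>_def)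
    qed
    then show "J \<sigma> \<in> (SIGMA k:M. pairings (M - {k}))" using s' by (simp add: J)
    have "{i\<in>insert m M. i < \<sigma> i} = insert m {i\<in>M - {k}. i < \<tau> i}"
    proof (rule set_eqI)
      fix i
      consider "i = m" | "i = k" | "i \<noteq> m" "i \<noteq> k" by blast
      then show "i \<in> {i\<in>insert m M. i < \<sigma> i} \<longleftrightarrow> i \<in> insert m {i\<in>M - {k}. i < \<tau> i}"
        by cases (use s' m[OF s'(1)] km in \<open>simp_all add: \<tau>_def\<close>)
    qed
    moreover have "(\<Prod>i\<in>{i\<in>M - {k}. i < \<tau> i}. g i (\<sigma> i)) = (\<Prod>i\<in>{i\<in>M - {k}. i < \<tau> i}. g i (\<tau> i))"
      using mM by (intro prod.cong) (auto simp: \<tau>_def)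
    ultimately have "(\<Prod>i\<in>{i\<in>insert m M. i < \<sigma> i}. g i (\<sigma> i)) = g m k * (\<Prod>i\<in>{i\<in>M - {k}. i < \<tau> i}. g i (\<tau> i))"
      using M mM by (simp add: k_def[symmetric])
    then show "(case J \<sigma> of (k, \<tau>) \<Rightarrow> g m k * (\<Prod>i\<in>{i\<in>M - {k}. i < \<tau> i}. g i (\<tau> i))) = (\<Prod>i\<in>{i\<in>insert m M. i < \<sigma> i}. g i (\<sigma> i))"
      by (simp add: J)
  next
    fix p assume "p \<in> (SIGMA k:M. pairings (M - {k}))"
    then obtain k \<tau> where p: "p = (k, \<tau>)" and k: "k \<in> M" and t: "\<tau> \<in> pairings (M - {k})" by auto
    have t': "\<tau> m = m" "\<tau> k = k" "k \<noteq> m" using k t mM by (auto simp: pairings_iff)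
    show "J (I p) = p"
      using t' by (auto simp: fun_eq_iff p I_def J_def)
    show "I p \<in> pairings (insert m M)"
      unfolding pairings_iff
    proof (intro conjI allI impI ballI)
      fix i assume "i \<notin> insert m M"
      then show "I p i = i" using k t by (auto simp: p I_def pairings_iff)
    next
      fix i assume i: "i \<in> insert m M"
      have "\<tau> i \<in> M - {k} \<and> \<tau> i \<noteq> i \<and> \<tau> (\<tau> i) = i" if "i \<in> M" "i \<noteq> k"
        using t that by (auto simp: pairings_iff)
      then show "I p i \<in> insert m M" "I p i \<noteq> i" "I p (I p i) = i"
        using i k t' mM by (auto simp: p I_def)
    qed
  qed
  also have "\<dots> = (\<Sum>k\<in>M. g m k * (\<Sum>\<tau>\<in>pairings (M - {k}). \<Prod>i\<in>{i\<in>M - {k}. i < \<tau> i}. g i (\<tau> i)))"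
    using M by (subst sum.Sigma[symmetric]) (auto simp: finite_pairings sum_distrib_left)
  finally show ?thesis .
qed

text \<open>The moments and the sums over matchings obey the same recursion. A step removes two
  elements, hence the induction over proper subsets. Odd sizes fit in without a case of their own:
  there the recursion ends in an empty sum on both sides.\<close>

lemma gaussian_Wick:
  fixes a :: "nat \<Rightarrow> 'a::euclidean_space"
  assumes "finite M"
  shows "(\<integral>x. (\<Prod>i\<in>M. a i \<bullet> x) * exp (- (x \<bullet> x)) \<partial>lborel) =
    sqrt pi ^ DIM('a) * (\<Sum>\<sigma>\<in>pairings M. \<Prod>i\<in>{i\<in>M. i < \<sigma> i}. (a i \<bullet> a (\<sigma> i)) / 2)"
  using assms
proof (induction M rule: finite_psubset_induct)
  case (psubset M)
  show ?case
  proof (cases "M = {}")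
    case True
    then show ?thesis by (simp add: pairings_empty integral_gaussian)
  next
    case False
    define m where "m = Min M"
    define N where "N = M - {m}"
    have m: "m \<in> M" using False psubset by (simp add: m_def)
    then have MN: "M = insert m N" "m \<notin> N" "finite N" using psubset by (auto simp: N_def)
    have "m < k" if "k \<in> N" for k
      using that psubset by (auto simp: N_def m_def order.strict_iff_order)
    then have rec: "(\<Sum>\<sigma>\<in>pairings (insert m N). \<Prod>i\<in>{i\<in>insert m N. i < \<sigma> i}. (a i \<bullet> a (\<sigma> i)) / 2) =
      (\<Sum>k\<in>N. (a m \<bullet> a k) / 2 * (\<Sum>\<tau>\<in>pairings (N - {k}). \<Prod>i\<in>{i\<in>N - {k}. i < \<tau> i}. (a i \<bullet> a (\<tau> i)) / 2))"
      by (rule sum_pairings_insert[OF MN(3), where g = "\<lambda>i j. (a i \<bullet> a j) / 2"])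
    have "(\<integral>x. (\<Prod>i\<in>N - {k}. a i \<bullet> x) * exp (- (x \<bullet> x)) \<partial>lborel) =
       sqrt pi ^ DIM('a) * (\<Sum>\<sigma>\<in>pairings (N - {k}). \<Prod>i\<in>{i\<in>N - {k}. i < \<sigma> i}. (a i \<bullet> a (\<sigma> i)) / 2)" if "k \<in> N" for k
      using MN by (intro psubset.IH) auto
    then have "(\<Sum>k\<in>N. (a m \<bullet> a k) / 2 * (\<integral>x. (\<Prod>i\<in>N - {k}. a i \<bullet> x) * exp (- (x \<bullet> x)) \<partial>lborel)) =
      (\<Sum>k\<in>N. sqrt pi ^ DIM('a) * ((a m \<bullet> a k) / 2 * (\<Sum>\<sigma>\<in>pairings (N - {k}). \<Prod>i\<in>{i\<in>N - {k}. i < \<sigma> i}. (a i \<bullet> a (\<sigma> i)) / 2)))"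
      by (intro sum.cong refl) (simp only: mult.left_commute)
    then show ?thesis
      unfolding MN(1) gaussian_recursion[OF MN(3,2)] rec sum_distrib_left[of "sqrt pi ^ DIM('a)"] .
  qed
qed

text \<open>A matching exchanges the lower and upper ends of its pairs. The count turns the factors
  1/2, one per pair, into a power of 2 common to all matchings.\<close>

lemma card_pairing_lower:
  assumes "finite A" "\<sigma> \<in> pairings A"
  shows "2 * card {i\<in>A. i < \<sigma> i} = card A"
proof -
  let ?L = "{i\<in>A. i < \<sigma> i}" and ?U = "{i\<in>A. \<sigma> i < i}"
  note p = assms(2)[unfolded pairings_iff]
  have "bij_betw \<sigma> ?L ?U"
    by (rule bij_betw_byWitness[where f' = \<sigma>]) (use p in auto)
  then have "card ?L = card ?U" by (rule bij_betw_same_card)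
  moreover have "A = ?L \<union> ?U" using p by (auto simp: neq_iff)
  then have "card A = card ?L + card ?U"
    using assms(1) by (metis (no_types, lifting) card_Un_disjoint disjoint_iff finite_Un less_asym mem_Collect_eq)
  ultimately show ?thesis by simp
qed

text \<open>Substituting \<xi> = A x, with the columns of \<open>A\<close> orthonormal for the form
  of \<open>P\<close>, turns the weight into exp(-(x \<bullet> x)). The coordinates of \<xi> become
  inner products of x with rows of \<open>A\<close>, whose Gram matrix is the inverse of
  \<open>P\<close>, and |det A| is 1/sqrt (det P).\<close>

lemma gaussian_pairing_sum:
  fixes P :: "real^'d^'d" and ns :: "nat \<Rightarrow> 'd"
  assumes P: "positive_definite P"
  shows "has_bochner_integral lborel (\<lambda>\<xi>. (\<Prod>i=1..2 * k. \<xi> $ ns i) * exp (- (\<xi> \<bullet> (P *v \<xi>))))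
    (pi powr (real CARD('d) / 2) / 2 ^ k * (pairing_sum (matrix_inv P) ns (2 * k) / sqrt (det P)))"
proof -
  obtain A :: "real^'d^'d" where A: "transpose A ** P ** A = mat 1"
    using positive_definite_orthonormal[OF P] .
  have "A ** (transpose A ** P) = mat 1"
    using A by (simp only: matrix_left_right_inverse[of A])
  then have "(A ** transpose A) ** P = mat 1" by (simp only: matrix_mul_assoc)
  then have "P ** (A ** transpose A) = mat 1" by (rule matrix_left_right_inverse1)
  then have inv: "matrix_inv P = A ** transpose A" by (rule matrix_inv_eqI)
  have "det (transpose A ** P ** A) = 1" unfolding A by simp
  then have d: "(det A)\<^sup>2 * det P = 1"
    by (simp add: det_mul power2_eq_square mult_ac)
  then have dA: "det A \<noteq> 0" by auto
  then have "det P = inverse ((det A)\<^sup>2)"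
    using d by (simp add: field_simps)
  then have sd: "1 / sqrt (det P) = \<bar>det A\<bar>"
    by (simp add: real_sqrt_inverse divide_inverse)
  define a where "a i = A $ ns i" for i
  have a: "(A *v x) $ ns i = a i \<bullet> x" for x i
    by (simp add: a_def matrix_vector_mul_component)
  have aa: "a i \<bullet> a j = matrix_inv P $ ns i $ ns j" for i j
    by (simp add: a_def inv matrix_matrix_mult_def transpose_def inner_vec_def)
  have q: "(A *v x) \<bullet> (P *v (A *v x)) = x \<bullet> x" for x
  proof -
    have "(A *v x) \<bullet> (P *v (A *v x)) = x \<bullet> ((transpose A ** P ** A) *v x)"
      by (metis dot_lmul_matrix vector_transpose_matrix matrix_vector_mul_assoc)
    then show ?thesis by (simp add: A)
  qed
  let ?S = "\<Sum>\<sigma>\<in>pairings {1..2 * k}. \<Prod>i\<in>{i\<in>{1..2 * k}. i < \<sigma> i}. (a i \<bullet> a (\<sigma> i)) / 2"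
  have S: "?S = pairing_sum (matrix_inv P) ns (2 * k) / 2 ^ k"
    unfolding pairing_sum_def sum_divide_distrib
  proof (rule sum.cong)
    fix \<sigma> assume "\<sigma> \<in> pairings {1..2 * k}"
    from card_pairing_lower[OF _ this] have "card {i\<in>{1..2 * k}. i < \<sigma> i} = k" by simp
    then show "(\<Prod>i\<in>{i\<in>{1..2 * k}. i < \<sigma> i}. (a i \<bullet> a (\<sigma> i)) / 2) =
        (\<Prod>i\<in>{i\<in>{1..2 * k}. i < \<sigma> i}. matrix_inv P $ ns i $ ns (\<sigma> i)) / 2 ^ k"
      by (simp add: aa prod_dividef)
  qed simp
  have "has_bochner_integral lborel (\<lambda>x. (\<Prod>i=1..2 * k. a i \<bullet> x) * exp (- (x \<bullet> x))) (sqrt pi ^ CARD('d) * ?S)"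
    using gaussian_Wick[of "{1..2 * k}" a] integrable_prod_inner_gaussian[of "{1..2 * k}" a]
    by (simp add: has_bochner_integral_iff)
  then have "has_bochner_integral lborel (\<lambda>x. (\<Prod>i=1..2 * k. (A *v x) $ ns i) * exp (- ((A *v x) \<bullet> (P *v (A *v x))))) (sqrt pi ^ CARD('d) * ?S)"
    by (simp only: a q)
  moreover have "(\<lambda>\<xi>. (\<Prod>i=1..2 * k. \<xi> $ ns i) * exp (- (\<xi> \<bullet> (P *v \<xi>)))) \<in> borel_measurable borel"
    by (intro borel_measurable_continuous_onI continuous_intros)
  ultimately have "has_bochner_integral lborel (\<lambda>\<xi>. (\<Prod>i=1..2 * k. \<xi> $ ns i) * exp (- (\<xi> \<bullet> (P *v \<xi>))))
      (\<bar>det A\<bar> * (sqrt pi ^ CARD('d) * ?S))"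
    using has_bochner_integral_lborel_linear[OF dA, where f = "\<lambda>\<xi>. (\<Prod>i=1..2 * k. \<xi> $ ns i) * exp (- (\<xi> \<bullet> (P *v \<xi>)))"] by blast
  moreover have "\<bar>det A\<bar> * (sqrt pi ^ CARD('d) * ?S) =
      pi powr (real CARD('d) / 2) / 2 ^ k * (pairing_sum (matrix_inv P) ns (2 * k) / sqrt (det P))"
  proof -
    have "sqrt pi ^ CARD('d) = pi powr (real CARD('d) / 2)"
      by (simp add: powr_half_sqrt[symmetric] powr_power)
    then show ?thesis by (simp only: S sd[symmetric]) simp
  qed
  ultimately show ?thesis by (simp only:)
qed

section \<open>Quadratic forms along the simplex\<close>

lemma positive_definite_lower_bound:
  fixes P :: "real^'d^'d"
  assumes "positive_definite P"
  obtains c where "0 < c" "\<And>x. c * (x \<bullet> x) \<le> x \<bullet> (P *v x)"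
proof -
  \<comment> \<open>The minimum over the compact unit sphere, the least eigenvalue, is the constant;
    homogeneity extends the bound to all vectors.\<close>
  have "\<exists>u\<in>sphere 0 1. \<forall>x\<in>sphere 0 1. u \<bullet> (P *v u) \<le> x \<bullet> (P *v (x::real^'d))"
    by (intro continuous_attains_inf continuous_intros) auto
  then obtain u :: "real^'d" where u: "norm u = 1" "\<And>x. norm x = 1 \<Longrightarrow> u \<bullet> (P *v u) \<le> x \<bullet> (P *v x)"
    by auto
  show thesis
  proof
    show "0 < u \<bullet> (P *v u)"
      using assms u(1) by (metis norm_zero positive_definite_def zero_neq_one)
    fix x :: "real^'d"
    show "(u \<bullet> (P *v u)) * (x \<bullet> x) \<le> x \<bullet> (P *v x)"
    proof (cases "x = 0")
      case False
      let ?y = "(1 / norm x) *\<^sub>R x"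
      have "u \<bullet> (P *v u) \<le> ?y \<bullet> (P *v ?y)" using False by (intro u(2)) simp
      also have "\<dots> = (x \<bullet> (P *v x)) / (x \<bullet> x)"
        by (simp add: matrix_vector_mult_scaleR dot_square_norm power2_eq_square)
      finally show ?thesis using False by (simp add: pos_le_divide_eq)
    qed simp
  qed
qed

lemma inner_P_comb:
  "x \<bullet> (P_comb P2 n t s *v x) = (\<Sum>j\<le>n. s j * (x \<bullet> (P2 (t j) *v x)))"
proof -
  have "P_comb P2 n t s *v x = (\<Sum>j\<le>n. s j *\<^sub>R (P2 (t j) *v x))"
    unfolding P_comb_def
    by (induction n) (simp_all add: matrix_vector_mult_add_rdistrib scaleR_matrix_vector_assoc)
  then show ?thesis by (simp add: inner_sum_right)
qed

lemma positive_definite_P_comb: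
  fixes P2 :: "real \<Rightarrow> real^'d^'d"
  assumes "\<And>j. j \<le> n \<Longrightarrow> positive_definite (P2 (t j))" and s: "s \<in> simplex_pts n"
  shows "positive_definite (P_comb P2 n t s)"
  unfolding positive_definite_def
proof (intro conjI allI impI)
  have "transpose (P2 (t j)) = P2 (t j)" if "j \<le> n" for j
    using assms(1)[OF that] by (simp add: positive_definite_def)
  then show "transpose (P_comb P2 n t s) = P_comb P2 n t s"
    by (simp add: P_comb_def transpose_def vec_eq_iff)
  fix x :: "real^'d" assume "x \<noteq> 0"
  then have pos: "0 < x \<bullet> (P2 (t j) *v x)" if "j \<le> n" for j
    using assms(1)[OF that] by (simp add: positive_definite_def)
  have s0: "0 \<le> s j" if "j \<le> n" for j using s that by (auto simp: simplex_pts_def)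
  have "\<exists>j\<le>n. s j \<noteq> 0"
  proof (rule ccontr)
    assume "\<not> ?thesis"
    then have "(\<Sum>j=0..n. s j) = 0" by (intro sum.neutral) auto
    then show False using s by (simp add: simplex_pts_def)
  qed
  then obtain j where j: "j \<le> n" "0 < s j" using s0 by (metis order_le_less)
  show "0 < x \<bullet> (P_comb P2 n t s *v x)"
    unfolding inner_P_comb
    by (rule sum_pos2[of _ j]) (use j pos s0 in \<open>auto intro!: mult_nonneg_nonneg less_imp_le[OF pos]\<close>)
qed

lemma contour_integrand_eq:
  "contour_integrand P2 n \<alpha> t \<xi> z = exp (- z) * resolvents n \<alpha> (\<lambda>j. \<xi> \<bullet> (P2 (t j) *v \<xi>)) z"
proof -
  have "(\<Sum>i\<in>UNIV. \<Sum>j\<in>UNIV. P $ i $ j * \<xi> $ i * \<xi> $ j) = \<xi> \<bullet> (P *v \<xi>)" for P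
    by (simp add: inner_vec_def matrix_vector_mult_def sum_distrib_left mult_ac)
  then show ?thesis
    by (simp add: contour_integrand_def resolvents_def B0_def)
qed

section \<open>Coordinates on the simplex\<close>

definition simplex_lift :: "nat \<Rightarrow> (nat \<Rightarrow> real) \<Rightarrow> nat \<Rightarrow> real" where
  "simplex_lift n u = u(0 := 1 - (\<Sum>j=1..n. u j))"

lemma simplex_measure_eq:
  "simplex_measure n = distr (Pi\<^sub>M {1..n} (\<lambda>_. lborel)) (Pi\<^sub>M {0..n} (\<lambda>_. borel)) (simplex_lift n)"
  by (simp add: simplex_measure_def simplex_lift_def[abs_def])

lemma measurable_simplex_lift:
  "simplex_lift n \<in> Pi\<^sub>M {1..n} (\<lambda>_. lborel) \<rightarrow>\<^sub>M Pi\<^sub>M {0..n} (\<lambda>_. borel)"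
proof -
  have "{0..n} = insert 0 {1..n}" by auto
  then show ?thesis
    unfolding simplex_lift_def
    by (simp only:) (rule measurable_fun_upd[where J="{1..n}"], auto intro!: measurable_PiM_single')
qed

lemma sets_simplex_pts: "simplex_pts n \<in> sets (Pi\<^sub>M {0..n} (\<lambda>_. borel))"
proof -
  have "simplex_pts n = {s \<in> space (Pi\<^sub>M {0..n} (\<lambda>_. borel)). (\<forall>j\<in>{0..n}. 0 \<le> s j) \<and> (\<Sum>j=0..n. s j) = 1}"
    by (auto simp: simplex_pts_def space_PiM)
  also have "\<dots> \<in> sets (Pi\<^sub>M {0..n} (\<lambda>_. borel))" by measurable
  finally show ?thesis .
qed

lemma simplex_lift_in_simplex_pts:
  assumes "u \<in> space (Pi\<^sub>M {1..n} (\<lambda>_. lborel))"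
  shows "simplex_lift n u \<in> simplex_pts n \<longleftrightarrow> (\<forall>j\<in>{1..n}. 0 \<le> u j) \<and> (\<Sum>j=1..n. u j) \<le> 1"
proof -
  have "simplex_lift n u \<in> space (Pi\<^sub>M {0..n} (\<lambda>_. borel))"
    using measurable_space[OF measurable_simplex_lift assms] .
  moreover have "{0..n} = insert 0 {1..n}" by auto
  moreover have "(\<Sum>j=1..n. simplex_lift n u j) = (\<Sum>j=1..n. u j)"
    by (intro sum.cong) (auto simp: simplex_lift_def)
  ultimately show ?thesis
    by (auto simp: simplex_pts_def space_PiM simplex_lift_def)
qed

lemma integrable_pair_mult:
  fixes f :: "'a \<Rightarrow> real" and g :: "'b \<Rightarrow> real"
  assumes "sigma_finite_measure M" "sigma_finite_measure N" and f: "integrable M f" and g: "integrable N g"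
  shows "integrable (M \<Otimes>\<^sub>M N) (\<lambda>(x, y). f x * g y)"
proof -
  interpret M: sigma_finite_measure M by fact
  interpret N: sigma_finite_measure N by fact
  interpret pair_sigma_finite M N ..
  note [measurable] = borel_measurable_integrable[OF f] borel_measurable_integrable[OF g]
  show ?thesis
    by (rule Fubini_integrable) (use f g in \<open>auto simp: abs_mult\<close>)
qed

section \<open>The joint integral over the simplex and the momenta\<close>

text \<open>With the indicator built in, both iterated integrals run over whole spaces. The degree
  \<open>m\<close> is kept separate from \<open>\<alpha>\<close>, since measurability and domination
  hold for every degree.\<close>

definition joint_integrand ::
    "(real \<Rightarrow> real^'d^'d) \<Rightarrow> (nat \<Rightarrow> 'd) \<Rightarrow> nat \<Rightarrow> (nat \<Rightarrow> nat) \<Rightarrow> (nat \<Rightarrow> real) \<Rightarrow> nat \<Rightarrow> (nat \<Rightarrow> real) \<Rightarrow> real^'d \<Rightarrow> real" where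
  "joint_integrand P2 ns n \<alpha> t m s \<xi> = indicator (simplex_pts n) s * (\<Prod>j\<le>n. s j ^ (\<alpha> j - 1)) *
     ((\<Prod>i=1..m. \<xi> $ ns i) * exp (- (\<xi> \<bullet> (P_comb P2 n t s *v \<xi>))))"

text \<open>The exponent is linear in \<open>s\<close>, so the exponential splits into one factor
  per coordinate. The cut-offs of these factors multiply to the indicator, because outside the
  simplex some lifted coordinate is negative. The factorials undo the normalisation in
  \<open>exp_monomial\<close>.\<close>

lemma joint_integrand_lift:
  assumes u: "u \<in> space (Pi\<^sub>M {1..n} (\<lambda>_. lborel))"
  shows "joint_integrand P2 ns n \<alpha> t m (simplex_lift n u) \<xi> = (\<Prod>i=1..m. \<xi> $ ns i) * (\<Prod>j\<le>n. fact (\<alpha> j - 1)) *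
    (exp_monomial (\<alpha> 0) (\<xi> \<bullet> (P2 (t 0) *v \<xi>)) (1 - (\<Sum>j=1..n. u j)) *
      (\<Prod>j=1..n. exp_monomial (\<alpha> j) (\<xi> \<bullet> (P2 (t j) *v \<xi>)) (u j)))"
proof -
  define s where "s = simplex_lift n u"
  define q where "q j = \<xi> \<bullet> (P2 (t j) *v \<xi>)" for j
  have i: "{..n} = insert 0 {1..n}" by auto
  have s: "s 0 = 1 - (\<Sum>j=1..n. u j)" "\<And>j. j \<in> {1..n} \<Longrightarrow> s j = u j"
    by (auto simp: s_def simplex_lift_def)
  have "exp_monomial (\<alpha> 0) (q 0) (1 - (\<Sum>j=1..n. u j)) * (\<Prod>j=1..n. exp_monomial (\<alpha> j) (q j) (u j)) =
      (\<Prod>j\<le>n. exp_monomial (\<alpha> j) (q j) (s j))"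
    unfolding i using s by (simp cong: prod.cong_simp)
  also have "(\<Prod>j\<le>n. fact (\<alpha> j - 1)) * \<dots> = indicator (simplex_pts n) s * (\<Prod>j\<le>n. s j ^ (\<alpha> j - 1)) * exp (- (\<Sum>j\<le>n. s j * q j))"
  proof (cases "s \<in> simplex_pts n")
    case True
    then have "0 \<le> s j" if "j \<le> n" for j using that by (auto simp: simplex_pts_def)
    then have "(\<Prod>j\<le>n. fact (\<alpha> j - 1)) * (\<Prod>j\<le>n. exp_monomial (\<alpha> j) (q j) (s j)) =
        (\<Prod>j\<le>n. s j ^ (\<alpha> j - 1) * exp (- (s j * q j)))"
      unfolding prod.distrib[symmetric] by (intro prod.cong refl) (simp add: exp_monomial_def)
    then show ?thesis using True
      by (simp add: prod.distrib exp_sum[symmetric] sum_negf[symmetric])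
  next
    case False
    then have "\<not> ((\<forall>j\<in>{1..n}. 0 \<le> u j) \<and> (\<Sum>j=1..n. u j) \<le> 1)"
      using simplex_lift_in_simplex_pts[OF u] by (simp add: s_def)
    then have "\<exists>j\<in>{..n}. s j < 0" unfolding i using s by (auto simp: not_le)
    then obtain j where "j \<le> n" "s j < 0" by auto
    then have "j \<in> {..n}" "exp_monomial (\<alpha> j) (q j) (s j) = 0"
      by (auto simp: exp_monomial_def)
    then have "(\<Prod>j\<le>n. exp_monomial (\<alpha> j) (q j) (s j)) = 0"
      by (intro prod_zero) auto
    then show ?thesis using False by simp
  qed
  finally show ?thesis
    by (simp add: joint_integrand_def inner_P_comb s_def[symmetric] q_def[symmetric] mult_ac)
qed

lemma integral_joint_integrand:
  fixes P2 :: "real \<Rightarrow> real^'d^'d"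
  assumes P: "\<And>j. j \<le> n \<Longrightarrow> positive_definite (P2 (t j))" and N: "2 \<le> tuple_abs n \<alpha>"
  shows "(\<integral>\<xi>. joint_integrand P2 ns n \<alpha> t (2 * tuple_abs n \<alpha> - 4) s \<xi> \<partial>lborel) =
    pi powr (real CARD('d) / 2) / 2 ^ (tuple_abs n \<alpha> - 2) * (indicator (simplex_pts n) s * simplex_integrand P2 ns n \<alpha> t s)"
proof (cases "s \<in> simplex_pts n")
  case True
  have m: "2 * tuple_abs n \<alpha> - 4 = 2 * (tuple_abs n \<alpha> - 2)" using N by simp
  show ?thesis
    unfolding joint_integrand_def simplex_integrand_def m
    using True has_bochner_integral_integral_eq[OF gaussian_pairing_sum[OF positive_definite_P_comb[of n P2 t, OF P True], of ns "tuple_abs n \<alpha> - 2"]]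
    by simp
qed (simp add: joint_integrand_def)

lemma measurable_joint_integrand [measurable]:
  "(\<lambda>(s, \<xi>). joint_integrand P2 ns n \<alpha> t m s \<xi>) \<in> borel_measurable (Pi\<^sub>M {0..n} (\<lambda>_. borel) \<Otimes>\<^sub>M lborel)"
proof -
  have [measurable]: "(\<lambda>\<xi>. \<xi> \<bullet> (P2 (t j) *v \<xi>)) \<in> borel_measurable lborel" "(\<lambda>\<xi>. \<xi> $ i) \<in> borel_measurable lborel" for j i
    by (simp_all, auto intro!: borel_measurable_continuous_onI continuous_intros)
  have [measurable]: "simplex_pts n \<in> sets (Pi\<^sub>M {0..n} (\<lambda>_. borel))"
    by (rule sets_simplex_pts)
  have i: "{..n} = {0..n}" by auto
  show ?thesis
    unfolding joint_integrand_def inner_P_comb i by measurable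
qed

text \<open>The weights lie in [0,1] and sum to 1, so monomials in them are at most 1 and a common
  lower bound of the forms also bounds their convex combination. This leaves a bound in which
  \<open>s\<close> enters through the indicator only.\<close>

lemma abs_joint_integrand_le:
  assumes P: "\<And>j. j \<le> n \<Longrightarrow> c * (\<xi> \<bullet> \<xi>) \<le> \<xi> \<bullet> (P2 (t j) *v \<xi>)"
  shows "\<bar>joint_integrand P2 ns n \<alpha> t m s \<xi>\<bar> \<le> indicator (simplex_pts n) s * (norm \<xi> ^ m * exp (- c * (\<xi> \<bullet> \<xi>)))"
proof (cases "s \<in> simplex_pts n")
  case True
  then have s: "0 \<le> s j" "s j \<le> 1" if "j \<le> n" for j
    using that member_le_sum[of j "{0..n}" s] by (auto simp: simplex_pts_def)
  have "\<bar>\<Prod>j\<le>n. s j ^ (\<alpha> j - 1)\<bar> \<le> 1"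
    unfolding abs_prod using s by (intro prod_le_1) (auto simp: power_abs intro!: power_le_one)
  moreover have "\<bar>\<Prod>i=1..m. \<xi> $ ns i\<bar> \<le> norm \<xi> ^ m"
  proof -
    have "\<bar>\<Prod>i=1..m. \<xi> $ ns i\<bar> \<le> (\<Prod>i=1..m. norm \<xi>)"
      unfolding abs_prod by (intro prod_mono) (auto simp: component_le_norm_cart)
    then show ?thesis by simp
  qed
  moreover have "c * (\<xi> \<bullet> \<xi>) \<le> \<xi> \<bullet> (P_comb P2 n t s *v \<xi>)"
  proof -
    have "c * (\<xi> \<bullet> \<xi>) = (\<Sum>j\<le>n. s j) * (c * (\<xi> \<bullet> \<xi>))"
      using True by (simp add: simplex_pts_def atMost_atLeast0)
    also have "\<dots> \<le> (\<Sum>j\<le>n. s j * (\<xi> \<bullet> (P2 (t j) *v \<xi>)))"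
      unfolding sum_distrib_right using s P by (intro sum_mono mult_left_mono) auto
    finally show ?thesis by (simp add: inner_P_comb)
  qed
  ultimately have "\<bar>\<Prod>j\<le>n. s j ^ (\<alpha> j - 1)\<bar> * (\<bar>\<Prod>i=1..m. \<xi> $ ns i\<bar> * exp (- (\<xi> \<bullet> (P_comb P2 n t s *v \<xi>))))
      \<le> 1 * (norm \<xi> ^ m * exp (- c * (\<xi> \<bullet> \<xi>)))"
    by (intro mult_mono) auto
  then show ?thesis
    using True by (simp add: joint_integrand_def abs_mult)
qed (simp add: joint_integrand_def)

lemma integrable_joint_integrand:
  assumes P: "\<And>j. j \<le> n \<Longrightarrow> positive_definite (P2 (t j))"
  shows "integrable (Pi\<^sub>M {1..n} (\<lambda>_. lborel) \<Otimes>\<^sub>M lborel) (\<lambda>(u, \<xi>). joint_integrand P2 ns n \<alpha> t m (simplex_lift n u) \<xi>)"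
proof -
  let ?U = "Pi\<^sub>M {1..n} (\<lambda>_. lborel) :: (nat \<Rightarrow> real) measure"
  interpret product_sigma_finite "\<lambda>_::nat. lborel :: real measure" ..
  interpret U: sigma_finite_measure ?U by (rule sigma_finite) simp
  have "\<forall>j. \<exists>c. j \<le> n \<longrightarrow> 0 < c \<and> (\<forall>\<xi>. c * (\<xi> \<bullet> \<xi>) \<le> \<xi> \<bullet> (P2 (t j) *v \<xi>))"
    using positive_definite_lower_bound[OF P] by metis
  then obtain c where c: "\<And>j. j \<le> n \<Longrightarrow> 0 < c j" "\<And>j \<xi>. j \<le> n \<Longrightarrow> c j * (\<xi> \<bullet> \<xi>) \<le> \<xi> \<bullet> (P2 (t j) *v \<xi>)"
    by metis
  \<comment> \<open>Finitely many points t_j occur, so the least of their constants is still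
    positive.\<close>
  define c0 where "c0 = Min (c ` {..n})"
  have c0: "0 < c0" using c(1) by (simp add: c0_def)
  have le: "c0 * (\<xi> \<bullet> \<xi>) \<le> \<xi> \<bullet> (P2 (t j) *v \<xi>)" if "j \<le> n" for j \<xi>
  proof -
    have "c0 \<le> c j" using that by (simp add: c0_def)
    then have "c0 * (\<xi> \<bullet> \<xi>) \<le> c j * (\<xi> \<bullet> \<xi>)" by (intro mult_right_mono) auto
    with c(2)[OF that] show ?thesis by (rule order_trans[rotated])
  qed
  have "emeasure ?U (simplex_lift n -` simplex_pts n \<inter> space ?U) = emeasure (simplex_measure n) (simplex_pts n)"
    unfolding simplex_measure_eq
    by (rule emeasure_distr[OF measurable_simplex_lift sets_simplex_pts, symmetric])
  also have "\<dots> < \<infinity>" by (simp add: emeasure_simplex_pts)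
  finally have "integrable ?U (indicator (simplex_lift n -` simplex_pts n \<inter> space ?U) :: _ \<Rightarrow> real)"
    using measurable_sets[OF measurable_simplex_lift sets_simplex_pts]
    by (intro integrable_real_indicator) auto
  then have "integrable ?U (\<lambda>u. indicator (simplex_pts n) (simplex_lift n u) :: real)"
    by (rule Bochner_Integration.integrable_cong[THEN iffD1, rotated 2]) (auto simp: indicator_def)
  then have "integrable (?U \<Otimes>\<^sub>M lborel) (\<lambda>(u, \<xi>). indicator (simplex_pts n) (simplex_lift n u) * (norm \<xi> ^ m * exp (- c0 * (\<xi> \<bullet> \<xi>))))"
    by (intro integrable_pair_mult integrable_norm_power_gaussian c0 U.sigma_finite_measure_axioms lborel.sigma_finite_measure_axioms)
  then show ?thesis
  proof (rule Bochner_Integration.integrable_bound)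
    note [measurable] = measurable_simplex_lift
    show "(\<lambda>(u, \<xi>). joint_integrand P2 ns n \<alpha> t m (simplex_lift n u) \<xi>) \<in> borel_measurable (?U \<Otimes>\<^sub>M lborel)"
    proof -
      have "(\<lambda>p. (simplex_lift n (fst p), snd p)) \<in> ?U \<Otimes>\<^sub>M lborel \<rightarrow>\<^sub>M Pi\<^sub>M {0..n} (\<lambda>_. borel) \<Otimes>\<^sub>M lborel"
        by measurable
      from measurable_compose[OF this measurable_joint_integrand] show ?thesis
        by (simp only: case_prod_unfold prod.sel)
    qed
    show "AE p in ?U \<Otimes>\<^sub>M lborel. norm (case p of (u, \<xi>) \<Rightarrow> joint_integrand P2 ns n \<alpha> t m (simplex_lift n u) \<xi>)
        \<le> norm (case p of (u, \<xi>) \<Rightarrow> indicator (simplex_pts n) (simplex_lift n u) * (norm \<xi> ^ m * exp (- c0 * (\<xi> \<bullet> \<xi>))))"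
      using abs_joint_integrand_le[where ?P2.0 = P2 and t = t and n = n, OF le] by (intro AE_I2) (auto simp: abs_mult split: prod.split)
  qed
qed

text \<open>The contour integral is -2 pi i c, where c is the simplex integral of the normalised
  factors, so division by 2 pi i leaves -c. The joint integrand carries the factorials in addition,
  hence the quotient. The formula is pointwise in \<xi> and includes \<xi> = 0, where all poles sit
  at 0.\<close>

lemma T_integrand_eq:
  assumes g: "encircles_nonneg_axis \<gamma>" and P: "\<And>j. j \<le> n \<Longrightarrow> positive_definite (P2 (t j))"
    and \<alpha>: "\<And>j. j \<le> n \<Longrightarrow> 0 < \<alpha> j"
  shows "line_integrable \<gamma> (contour_integrand P2 n \<alpha> t \<xi>)"
    and "T_integrand \<gamma> P2 ns n \<alpha> t \<xi> = of_real (- (1 / (\<Prod>j\<le>n. fact (\<alpha> j - 1))) *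
      (\<integral>u. joint_integrand P2 ns n \<alpha> t (2 * tuple_abs n \<alpha> - 4) (simplex_lift n u) \<xi> \<partial>Pi\<^sub>M {1..n} (\<lambda>_. lborel)))"
proof -
  let ?U = "Pi\<^sub>M {1..n} (\<lambda>_. lborel) :: (nat \<Rightarrow> real) measure"
  define q where "q j = \<xi> \<bullet> (P2 (t j) *v \<xi>)" for j
  have q: "0 \<le> q j" if "j \<le> n" for j
    using P[OF that] by (cases "\<xi> = 0") (auto simp: q_def positive_definite_def less_imp_le)
  define E where "E u = exp_monomial (\<alpha> 0) (q 0) (1 - (\<Sum>j=1..n. u j)) * (\<Prod>j=1..n. exp_monomial (\<alpha> j) (q j) (u j))" for u
  obtain c where c: "0 \<le> c" "(\<integral>\<^sup>+u. ennreal (E u) \<partial>?U) = ennreal c"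
    "((\<lambda>u. exp (- \<gamma> u) * resolvents n \<alpha> q (\<gamma> u) * vector_derivative \<gamma> (at u)) has_integral
      - (2 * of_real pi * \<i> * of_real c)) UNIV"
    by (rule line_integral_resolvents[OF g, where n = n and q = q and \<alpha> = \<alpha>])
      (use q \<alpha> in \<open>auto simp: E_def\<close>)
  have ci: "contour_integrand P2 n \<alpha> t \<xi> z = exp (- z) * resolvents n \<alpha> q z" for z
    unfolding q_def by (rule contour_integrand_eq)
  show "line_integrable \<gamma> (contour_integrand P2 n \<alpha> t \<xi>)"
    unfolding line_integrable_def ci using c(3) by blast
  have li: "line_integral \<gamma> (contour_integrand P2 n \<alpha> t \<xi>) = - (2 * of_real pi * \<i> * of_real c)"
    unfolding line_integral_def ci using c(3) by (rule integral_unique)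
  have "E \<in> borel_measurable ?U" unfolding E_def by measurable
  moreover have "0 \<le> E u" for u
    by (simp add: E_def exp_monomial_nonneg prod_nonneg)
  ultimately have "(\<integral>u. E u \<partial>?U) = c"
    using c(1,2) by (simp add: integral_eq_nn_integral)
  then have "(\<integral>u. joint_integrand P2 ns n \<alpha> t (2 * tuple_abs n \<alpha> - 4) (simplex_lift n u) \<xi> \<partial>?U) =
      (\<Prod>i=1..2 * tuple_abs n \<alpha> - 4. \<xi> $ ns i) * (\<Prod>j\<le>n. fact (\<alpha> j - 1)) * c"
    by (subst Bochner_Integration.integral_cong[OF refl joint_integrand_lift]) (simp_all add: E_def q_def)
  moreover have "(\<Prod>j\<le>n. fact (\<alpha> j - 1) :: real) \<noteq> 0" by simp
  ultimately show "T_integrand \<gamma> P2 ns n \<alpha> t \<xi> = of_real (- (1 / (\<Prod>j\<le>n. fact (\<alpha> j - 1))) *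
      (\<integral>u. joint_integrand P2 ns n \<alpha> t (2 * tuple_abs n \<alpha> - 4) (simplex_lift n u) \<xi> \<partial>?U))"
    unfolding T_integrand_def li by simp
qed

theorem lemma3p2:
  fixes P2 :: "real \<Rightarrow> real^'d^'d" and I :: "real set"
    and \<gamma> :: "real \<Rightarrow> complex"
    and n :: nat and \<alpha> :: "nat \<Rightarrow> nat" and ns :: "nat \<Rightarrow> 'd" and t :: "nat \<Rightarrow> real"
  assumes "open I"
    and "\<And>x. x \<in> I \<Longrightarrow> positive_definite (P2 x)"
    and "\<And>i j. smooth_on I (\<lambda>x. P2 x $ i $ j)"
    and "encircles_nonneg_axis \<gamma>"
    and "\<And>j. j \<le> n \<Longrightarrow> 0 < \<alpha> j"
    and "2 \<le> tuple_abs n \<alpha>"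
    and "\<And>j. j \<le> n \<Longrightarrow> t j \<in> I"
  shows "(\<forall>\<xi>. line_integrable \<gamma> (contour_integrand P2 n \<alpha> t \<xi>)) \<and>
    integrable lborel (T_integrand \<gamma> P2 ns n \<alpha> t) \<and>
    set_integrable (simplex_measure n) (simplex_pts n) (simplex_integrand P2 ns n \<alpha> t) \<and>
    T_fun \<gamma> P2 ns n \<alpha> t =
      of_real (1 / (2 ^ (tuple_abs n \<alpha> - 2) * (\<Prod>j\<le>n. fact (\<alpha> j - 1))) *
        (LINT s:simplex_pts n|simplex_measure n. simplex_integrand P2 ns n \<alpha> t s))"
proof -
  let ?U = "Pi\<^sub>M {1..n} (\<lambda>_. lborel) :: (nat \<Rightarrow> real) measure"
  let ?S = "Pi\<^sub>M {0..n} (\<lambda>_. borel) :: (nat \<Rightarrow> real) measure"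
  interpret product_sigma_finite "\<lambda>_::nat. lborel :: real measure" ..
  interpret U: sigma_finite_measure ?U by (rule sigma_finite) simp
  interpret pair_sigma_finite ?U "lborel :: (real^'d) measure" ..
  have P: "positive_definite (P2 (t j))" if "j \<le> n" for j
    using assms(2,7) that by blast
  note T = T_integrand_eq[where ?P2.0 = P2 and t = t and n = n, OF assms(4) P assms(5)]
  define J where "J = joint_integrand P2 ns n \<alpha> t (2 * tuple_abs n \<alpha> - 4)"
  define b where "b = (\<Prod>j\<le>n. fact (\<alpha> j - 1) :: real)"
  define C where "C = pi powr (real CARD('d) / 2) / 2 ^ (tuple_abs n \<alpha> - 2)"
  have C: "C \<noteq> 0" by (simp add: C_def)
  define f where "f s = indicator (simplex_pts n) s * simplex_integrand P2 ns n \<alpha> t s" for s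
  have TJ: "T_integrand \<gamma> P2 ns n \<alpha> t \<xi> = of_real (- (1 / b) * (\<integral>u. J (simplex_lift n u) \<xi> \<partial>?U))" for \<xi>
    unfolding b_def J_def by (rule T(2))
  have int: "integrable (?U \<Otimes>\<^sub>M lborel) (\<lambda>(u, \<xi>). J (simplex_lift n u) \<xi>)"
    unfolding J_def by (intro integrable_joint_integrand P)
  have Jf: "(\<integral>\<xi>. J s \<xi> \<partial>lborel) = C * f s" for s
    unfolding J_def C_def f_def by (intro integral_joint_integrand P assms(6))
  \<comment> \<open>As a multiple of a partial integral of \<open>J\<close>, the simplex integrand
    inherits measurability and integrability from the joint one; how the inverse and the determinant
    of P(s) vary with s never has to be examined.\<close>
  have f_eq: "f = (\<lambda>s. (1 / C) * (\<integral>\<xi>. J s \<xi> \<partial>lborel))"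
    using C by (simp add: Jf)
  have "(\<lambda>s. \<integral>\<xi>. J s \<xi> \<partial>lborel) \<in> borel_measurable ?S"
    unfolding J_def by measurable
  then have f_meas: "f \<in> borel_measurable ?S"
    unfolding f_eq by (intro borel_measurable_times borel_measurable_const)
  have "integrable ?U (\<lambda>u. (1 / C) * (\<integral>\<xi>. J (simplex_lift n u) \<xi> \<partial>lborel))"
    by (intro integrable_mult_right integrable_fst[OF int])
  then have "integrable ?U (\<lambda>u. f (simplex_lift n u))"
    by (simp only: f_eq)
  then have fi: "integrable (simplex_measure n) f"
    unfolding simplex_measure_eq by (rule integrable_distr_eq[OF measurable_simplex_lift f_meas, THEN iffD2])
  have Ti: "integrable lborel (T_integrand \<gamma> P2 ns n \<alpha> t)"
    unfolding TJ[abs_def] using integrable_snd[OF int]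
    by (intro integrable_of_real integrable_mult_right)
  have "(LINT \<xi>|lborel. T_integrand \<gamma> P2 ns n \<alpha> t \<xi>) = of_real (- (1 / b) * (\<integral>\<xi>. \<integral>u. J (simplex_lift n u) \<xi> \<partial>?U \<partial>lborel))"
    unfolding TJ by (simp only: integral_complex_of_real integral_mult_right_zero)
  \<comment> \<open>On the left \<xi> is integrated last, as in the definition of T; on the right it
    is integrated first, as Wick's formula demands.\<close>
  also have "(\<integral>\<xi>. \<integral>u. J (simplex_lift n u) \<xi> \<partial>?U \<partial>lborel) = (\<integral>u. \<integral>\<xi>. J (simplex_lift n u) \<xi> \<partial>lborel \<partial>?U)"
    by (rule Fubini_integral[OF int])
  also have "\<dots> = C * (\<integral>u. f (simplex_lift n u) \<partial>?U)"
    by (simp only: Jf integral_mult_right_zero)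
  also have "(\<integral>u. f (simplex_lift n u) \<partial>?U) = (\<integral>s. f s \<partial>simplex_measure n)"
    unfolding simplex_measure_eq by (rule integral_distr[OF measurable_simplex_lift f_meas, symmetric])
  also have "(\<integral>s. f s \<partial>simplex_measure n) = (LINT s:simplex_pts n|simplex_measure n. simplex_integrand P2 ns n \<alpha> t s)"
    by (simp add: set_lebesgue_integral_def f_def)
  finally have "T_fun \<gamma> P2 ns n \<alpha> t = of_real (- 1 / pi powr (real CARD('d) / 2) *
      (- (1 / b) * (C * (LINT s:simplex_pts n|simplex_measure n. simplex_integrand P2 ns n \<alpha> t s))))"
    unfolding T_fun_def by (simp only: of_real_mult)
  \<comment> \<open>The minus signs from T and from the contour cancel, and the power of pi in
    \<open>C\<close> cancels the normalisation of T.\<close>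
  also have "- 1 / pi powr (real CARD('d) / 2) *
      (- (1 / b) * (C * (LINT s:simplex_pts n|simplex_measure n. simplex_integrand P2 ns n \<alpha> t s))) =
      1 / (2 ^ (tuple_abs n \<alpha> - 2) * b) * (LINT s:simplex_pts n|simplex_measure n. simplex_integrand P2 ns n \<alpha> t s)"
    by (simp add: C_def)
  finally show ?thesis
    using T(1) Ti fi unfolding b_def set_integrable_def f_def[abs_def] by simp
qed

end
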